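(* Let $\mathbf{A}$ be a Medvedev degree such that there is a join-irreducible Medvedev degree $\mathbf{J}$ with $\mathbf{0}'<_M\mathbf{J}\le_M\mathbf{A}$. Then ${\rm Th}(\mathfrak{M}/\mathbf{A})\subseteq{\sf Jan}$.
   Context: A mass problem is a subset of Baire space $\omega^\omega$. $\mathcal{A}\le_M\mathcal{B}$ iff there is a partial Turing functional $\Psi$ such that for every $f\in\mathcal{B}$, $\Psi(f)$ is defined and $\Psi(f)\in\mathcal{A}$; Medvedev degrees are the $\equiv_M$-classes, forming the Brouwer algebra $\mathfrak{M}$ (bounded distributive lattice with $a\rightarrow b=\min\{c:a+c\ge b\}$) under join $\mathcal{A}+\mathcal{B}=\{f\oplus g: f\in\mathcal{A},g\in\mathcal{B}\}$, meet $\mathcal{A}\times\mathcal{B}=\{\langle0\rangle^\frown f:f\in\mathcal{A}\}\cup\{\langle1\rangle^\frown g:g\in\mathcal{B}\}$ and implication $\mathcal{A}\rightarrow\mathcal{B}=\{\langle z\rangle^\frown f:\forall g\in\mathcal{B}\,(\Phi_z(g\oplus f)\in\mathcal{A})\}$. $\mathbf{0}'$ is the degree of $\{f: f\text{ not computable}\}$. An element $a$ is join-irreducible if there are no $b,c<a$ with $a=b+c$. For a Brouwer algebra $\mathfrak{L}$ and $a\in\mathfrak{L}$, $\mathfrak{L}/a$ is the Brouwer algebra on $[0,a]$ with the same join, meet and $\rightarrow$, top $a$, negation $\neg b=b\rightarrow a$. ${\rm Th}(\mathfrak{L})$ is the set of propositional formulas evaluating to the top under every valuation in $\mathfrak{L}$,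 interpreting $\wedge$ as $+$, $\vee$ as $\times$, $\rightarrow$ as $\rightarrow$, $\neg p$ as $p\rightarrow1$. ${\sf Jan}={\sf IPC}+(\neg p\vee\neg\neg p)$.
   Formalization: Th is read as the formulas always evaluating to the least element 0 (truth, as ∧ is +), not to the top, since p∧¬p always takes the top value; A→B is the problem of computing elements of B from those of A, as a→b=min{c: a+c≥b} requires, the reverse of the displayed formula. *)

theory Defs
  imports Main "HOL-Library.Nat_Bijection"
begin

section \<open>Turing functionals\<close>

text \<open>Oracle programs for unary partial functions on the naturals, with the Cantor pairing
  \<^const>\<open>prod_encode\<close> used to pass several arguments. These are the partial recursive functions
  (primitive recursion and unbounded search) with an additional basic function, the oracle.\<close>

datatype prog =
    Zero | Succ | Left | Right | Oracle
  | Pair prog prog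
  | Comp prog prog
  | Prec prog prog
  | Mn prog

text \<open>\<open>exec f p x\<close> is the output of \<open>p\<close> with oracle \<open>f\<close> on input \<open>x\<close>, \<^const>\<open>None\<close> meaning divergence.
  A search by \<^const>\<open>Mn\<close> diverges if it meets a divergent value before the first zero.\<close>

primrec exec :: "(nat \<Rightarrow> nat) \<Rightarrow> prog \<Rightarrow> nat \<Rightarrow> nat option" where
  "exec f Zero = (\<lambda>x. Some 0)"
| "exec f Succ = (\<lambda>x. Some (Suc x))"
| "exec f Left = (\<lambda>x. Some (fst (prod_decode x)))"
| "exec f Right = (\<lambda>x. Some (snd (prod_decode x)))"
| "exec f Oracle = (\<lambda>x. Some (f x))"
| "exec f (Pair p q) = (\<lambda>x. Option.bind (exec f p x) (\<lambda>a.
     Option.bind (exec f q x) (\<lambda>b. Some (prod_encode (a, b)))))"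
| "exec f (Comp p q) = (\<lambda>x. Option.bind (exec f q x) (exec f p))"
| "exec f (Prec p q) = (\<lambda>x. case prod_decode x of (a, n) \<Rightarrow>
     rec_nat (exec f p a)
       (\<lambda>m r. Option.bind r (\<lambda>y. exec f q (prod_encode (a, prod_encode (m, y))))) n)"
| "exec f (Mn p) = (\<lambda>x.
     if \<exists>n. exec f p (prod_encode (x, n)) = Some 0 \<and>
          (\<forall>m<n. exec f p (prod_encode (x, m)) \<noteq> None)
     then Some (LEAST n. exec f p (prod_encode (x, n)) = Some 0)
     else None)"

text \<open>The partial Turing functional computed by a program; it is defined at \<open>f\<close> only if
  the program with oracle \<open>f\<close> halts on every input.\<close>

definition functional :: "prog \<Rightarrow> (nat \<Rightarrow> nat) \<Rightarrow> (nat \<Rightarrow> nat) option" where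
  "functional p f =
     (if \<forall>n. exec f p n \<noteq> None then Some (\<lambda>n. the (exec f p n)) else None)"

text \<open>An effective numbering of all programs; the choice of numbering must be effective for the
  implication on mass problems below to be the Brouwer implication.\<close>

lemma prod_decode_le: "fst (prod_decode n) \<le> n" "snd (prod_decode n) \<le> n"
  using le_prod_encode_1[of "fst (prod_decode n)" "snd (prod_decode n)"]
    le_prod_encode_2[of "snd (prod_decode n)" "fst (prod_decode n)"] by simp_all

function prog_of :: "nat \<Rightarrow> prog" where
  "prog_of z =
    (if z = 0 then Zero else if z = 1 then Succ else if z = 2 then Left
     else if z = 3 then Right else if z = 4 then Oracle
     else let k = (z - 5) div 4; i = (z - 5) mod 4;
              a = fst (prod_decode k); b = snd (prod_decode k) in
       if i = 0 then Pair (prog_of a) (prog_of b)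
       else if i = 1 then Comp (prog_of a) (prog_of b)
       else if i = 2 then Prec (prog_of a) (prog_of b)
       else Mn (prog_of k))"
  by pat_completeness auto
termination
proof -
  have "fst (prod_decode ((z - 5) div 4)) < z \<and> snd (prod_decode ((z - 5) div 4)) < z \<and>
      (z - 5) div 4 < z" if "z \<noteq> 0" for z :: nat
  proof -
    have "(z - 5) div 4 < z" using that by linarith
    then show ?thesis using prod_decode_le[of "(z - 5) div 4"] by linarith
  qed
  then show ?thesis by (relation "measure id") simp_all
qed

declare prog_of.simps [simp del]

definition Phi :: "nat \<Rightarrow> (nat \<Rightarrow> nat) \<Rightarrow> (nat \<Rightarrow> nat) option" where
  "Phi z = functional (prog_of z)"

lemma surj_prog_of: "surj prog_of"
proof -
  have arith: "Suc (4 * k) div 4 = k" "Suc (4 * k) mod 4 = Suc 0"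
    "Suc (Suc (4 * k)) div 4 = k" "Suc (Suc (4 * k)) mod 4 = 2"
    "(4 * k + 2) div 4 = k" "(4 * k + 2) mod 4 = 2"
    "(4 * k + 3) div 4 = k" "(4 * k + 3) mod 4 = 3" for k :: nat
    by presburger+
  have "\<exists>z. prog_of z = p" for p
  proof (induction p)
    case Zero show ?case by (rule exI[of _ 0]) (simp add: prog_of.simps)
  next
    case Succ show ?case by (rule exI[of _ 1]) (simp add: prog_of.simps)
  next
    case Left show ?case by (rule exI[of _ 2]) (simp add: prog_of.simps)
  next
    case Right show ?case by (rule exI[of _ 3]) (simp add: prog_of.simps)
  next
    case Oracle show ?case by (rule exI[of _ 4]) (simp add: prog_of.simps)
  next
    case (Pair p q)
    then obtain a b where "prog_of a = p" "prog_of b = q" by blast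
    then have "prog_of (5 + 4 * prod_encode (a, b)) = Pair p q"
      by (subst prog_of.simps) (simp add: Let_def arith)
    then show ?case ..
  next
    case (Comp p q)
    then obtain a b where "prog_of a = p" "prog_of b = q" by blast
    then have "prog_of (5 + (4 * prod_encode (a, b) + 1)) = Comp p q"
      by (subst prog_of.simps) (simp add: Let_def arith)
    then show ?case ..
  next
    case (Prec p q)
    then obtain a b where "prog_of a = p" "prog_of b = q" by blast
    then have "prog_of (5 + (4 * prod_encode (a, b) + 2)) = Prec p q"
      by (subst prog_of.simps) (simp add: Let_def arith)
    then show ?case ..
  next
    case (Mn p)
    then obtain a where "prog_of a = p" by blast
    then have "prog_of (5 + (4 * a + 3)) = Mn p"
      by (subst prog_of.simps) (simp add: Let_def arith)
    then show ?case ..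
  qed
  then show ?thesis by (metis surjI)
qed

text \<open>Computability without an oracle is computability from the zero function.\<close>

definition computable :: "(nat \<Rightarrow> nat) \<Rightarrow> bool" where
  "computable f \<longleftrightarrow> (\<exists>p. functional p (\<lambda>_. 0) = Some f)"


section \<open>Mass problems and Medvedev reducibility\<close>

type_synonym mass_problem = "(nat \<Rightarrow> nat) set"

definition medvedev_le :: "mass_problem \<Rightarrow> mass_problem \<Rightarrow> bool"  (infix "\<le>\<^sub>M" 50) where
  "A \<le>\<^sub>M B \<longleftrightarrow> (\<exists>p. \<forall>f\<in>B. \<exists>g\<in>A. functional p f = Some g)"

definition medvedev_equiv :: "mass_problem \<Rightarrow> mass_problem \<Rightarrow> bool"  (infix "\<equiv>\<^sub>M" 50) where
  "A \<equiv>\<^sub>M B \<longleftrightarrow> A \<le>\<^sub>M B \<and> B \<le>\<^sub>M A"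

definition oplus :: "(nat \<Rightarrow> nat) \<Rightarrow> (nat \<Rightarrow> nat) \<Rightarrow> nat \<Rightarrow> nat"  (infixl "\<oplus>" 65) where
  "(f \<oplus> g) n = (if even n then f (n div 2) else g (n div 2))"

text \<open>\<open>\<langle>n\<rangle>\<^sup>\<frown>f\<close> is \<^term>\<open>case_nat n f\<close>.\<close>

definition mp_join :: "mass_problem \<Rightarrow> mass_problem \<Rightarrow> mass_problem" where
  "mp_join A B = {f \<oplus> g | f g. f \<in> A \<and> g \<in> B}"

definition mp_meet :: "mass_problem \<Rightarrow> mass_problem \<Rightarrow> mass_problem" where
  "mp_meet A B = case_nat 0 ` A \<union> case_nat 1 ` B"

text \<open>The least \<open>C\<close> (up to equivalence) such that \<open>B\<close> is reducible to the join of \<open>A\<close> and \<open>C\<close>.\<close>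

definition mp_imp :: "mass_problem \<Rightarrow> mass_problem \<Rightarrow> mass_problem" where
  "mp_imp A B = {case_nat z f | z f. \<forall>g\<in>A. \<exists>h\<in>B. Phi z (g \<oplus> f) = Some h}"

primrec oracle_subst :: "prog \<Rightarrow> prog \<Rightarrow> prog" where
  "oracle_subst r Zero = Zero"
| "oracle_subst r Succ = Succ"
| "oracle_subst r Left = Left"
| "oracle_subst r Right = Right"
| "oracle_subst r Oracle = r"
| "oracle_subst r (Pair p q) = Pair (oracle_subst r p) (oracle_subst r q)"
| "oracle_subst r (Comp p q) = Comp (oracle_subst r p) (oracle_subst r q)"
| "oracle_subst r (Prec p q) = Prec (oracle_subst r p) (oracle_subst r q)"
| "oracle_subst r (Mn p) = Mn (oracle_subst r p)"

lemma functional_exec: "functional p f = Some g \<Longrightarrow> exec f p n = Some (g n)"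
  by (auto simp: functional_def split: if_splits)

lemma exec_oracle_subst:
  assumes "functional r f = Some g"
  shows "exec f (oracle_subst r p) = exec g p"
proof (induction p)
  case Oracle
  show ?case using functional_exec[OF assms] by (simp add: fun_eq_iff)
qed (simp_all only: exec.simps oracle_subst.simps)

lemma functional_oracle_subst:
  "functional r f = Some g \<Longrightarrow> functional (oracle_subst r p) f = functional p g"
  unfolding functional_def[of "oracle_subst r p"] functional_def[of p]
  by (simp add: exec_oracle_subst)

lemma medvedev_le_refl: "A \<le>\<^sub>M A"
  unfolding medvedev_le_def by (rule exI[of _ Oracle]) (simp add: functional_def)

lemma medvedev_le_trans: "A \<le>\<^sub>M B \<Longrightarrow> B \<le>\<^sub>M C \<Longrightarrow> A \<le>\<^sub>M C"
  unfolding medvedev_le_def by (metis functional_oracle_subst)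


section \<open>The Medvedev degrees\<close>

quotient_type mdegree = mass_problem / medvedev_equiv
  by (rule equivpI)
    (auto simp: reflp_def symp_def transp_def medvedev_equiv_def
      intro: medvedev_le_refl medvedev_le_trans)

instantiation mdegree :: order
begin

lift_definition less_eq_mdegree :: "mdegree \<Rightarrow> mdegree \<Rightarrow> bool" is medvedev_le
  by (auto simp: medvedev_equiv_def intro: medvedev_le_trans)

definition less_mdegree :: "mdegree \<Rightarrow> mdegree \<Rightarrow> bool" where
  "less_mdegree a b \<longleftrightarrow> a \<le> b \<and> \<not> b \<le> a"

instance
proof
  fix a b c :: mdegree
  show "a < b \<longleftrightarrow> a \<le> b \<and> \<not> b \<le> a" by (rule less_mdegree_def)
  show "a \<le> a" by transfer (rule medvedev_le_refl)
  show "a \<le> b \<Longrightarrow> b \<le> c \<Longrightarrow> a \<le> c" by transfer (rule medvedev_le_trans)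
  show "a \<le> b \<Longrightarrow> b \<le> a \<Longrightarrow> a = b" by transfer (simp add: medvedev_equiv_def)
qed

end

text \<open>The operations on mass problems respect \<open>\<equiv>\<^sub>M\<close>, so the representatives chosen by
  \<^const>\<open>rep_mdegree\<close> do not matter.\<close>

definition mdegree_join :: "mdegree \<Rightarrow> mdegree \<Rightarrow> mdegree" where
  "mdegree_join a b = abs_mdegree (mp_join (rep_mdegree a) (rep_mdegree b))"

definition mdegree_meet :: "mdegree \<Rightarrow> mdegree \<Rightarrow> mdegree" where
  "mdegree_meet a b = abs_mdegree (mp_meet (rep_mdegree a) (rep_mdegree b))"

definition mdegree_imp :: "mdegree \<Rightarrow> mdegree \<Rightarrow> mdegree" where
  "mdegree_imp a b = abs_mdegree (mp_imp (rep_mdegree a) (rep_mdegree b))"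

definition zero_prime :: mdegree where
  "zero_prime = abs_mdegree {f. \<not> computable f}"


section \<open>Brouwer algebras\<close>

text \<open>The data of a Brouwer algebra on a subset of a partially ordered type; the order of the
  algebra is that of the type.\<close>

record 'a brouwer =
  carr :: "'a set"
  join :: "'a \<Rightarrow> 'a \<Rightarrow> 'a"
  meet :: "'a \<Rightarrow> 'a \<Rightarrow> 'a"
  imp :: "'a \<Rightarrow> 'a \<Rightarrow> 'a"
  least :: 'a
  greatest :: 'a

definition medvedev :: "mdegree brouwer" where
  "medvedev = \<lparr>carr = UNIV, join = mdegree_join, meet = mdegree_meet, imp = mdegree_imp,
     least = abs_mdegree UNIV, greatest = abs_mdegree {}\<rparr>"

definition factor :: "'a::order brouwer \<Rightarrow> 'a \<Rightarrow> 'a brouwer" where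
  "factor L a = L\<lparr>carr := {b \<in> carr L. b \<le> a}, greatest := a\<rparr>"

definition join_irreducible :: "'a::order brouwer \<Rightarrow> 'a \<Rightarrow> bool" where
  "join_irreducible L a \<longleftrightarrow>
     a \<in> carr L \<and> \<not> (\<exists>b\<in>carr L. \<exists>c\<in>carr L. b < a \<and> c < a \<and> a = join L b c)"


section \<open>Propositional logic\<close>

datatype form =
  Atom nat | Con form form | Dis form form | Imp form form | Neg form

primrec form_value :: "'a brouwer \<Rightarrow> (nat \<Rightarrow> 'a) \<Rightarrow> form \<Rightarrow> 'a" where
  "form_value L v (Atom n) = v n"
| "form_value L v (Con p q) = join L (form_value L v p) (form_value L v q)"
| "form_value L v (Dis p q) = meet L (form_value L v p) (form_value L v q)"
| "form_value L v (Imp p q) = imp L (form_value L v p) (form_value L v q)"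
| "form_value L v (Neg p) = imp L (form_value L v p) (greatest L)"

text \<open>Conjunction being the join, truth is the least element: \<open>p \<rightarrow> p\<close> takes the value
  \<open>min {c. p + c \<ge> p} = 0\<close>.\<close>

definition Th :: "'a brouwer \<Rightarrow> form set" where
  "Th L = {p. \<forall>v. range v \<subseteq> carr L \<longrightarrow> form_value L v p = least L}"

text \<open>The Hilbert calculus for intuitionistic propositional logic extended by the axiom
  schemes whose instances form the set \<open>X\<close>.\<close>

inductive_set IPC_plus :: "form set \<Rightarrow> form set" for X :: "form set" where
  extra: "p \<in> X \<Longrightarrow> p \<in> IPC_plus X"
| K: "Imp p (Imp q p) \<in> IPC_plus X"
| S: "Imp (Imp p (Imp q r)) (Imp (Imp p q) (Imp p r)) \<in> IPC_plus X"
| ConI: "Imp p (Imp q (Con p q)) \<in> IPC_plus X"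
| ConE1: "Imp (Con p q) p \<in> IPC_plus X"
| ConE2: "Imp (Con p q) q \<in> IPC_plus X"
| DisI1: "Imp p (Dis p q) \<in> IPC_plus X"
| DisI2: "Imp q (Dis p q) \<in> IPC_plus X"
| DisE: "Imp (Imp p r) (Imp (Imp q r) (Imp (Dis p q) r)) \<in> IPC_plus X"
| NegI: "Imp (Imp p q) (Imp (Imp p (Neg q)) (Neg p)) \<in> IPC_plus X"
| NegE: "Imp (Neg p) (Imp p q) \<in> IPC_plus X"
| MP: "Imp p q \<in> IPC_plus X \<Longrightarrow> p \<in> IPC_plus X \<Longrightarrow> q \<in> IPC_plus X"

definition Jan :: "form set" where
  "Jan = IPC_plus {Dis (Neg p) (Neg (Neg p)) | p. True}"

end

theory Submission
  imports Defs
begin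

text \<open>Let \<open>J\<close> be join-irreducible with \<open>0' < J \<le> A\<close>. A list-coding argument yields a noncomputable \<open>f\<close> that
  computes no element of \<open>J\<close>. Finite modifications \<open>F d\<close> of \<open>f\<close> can be chosen so independent that no
  noncomputable function is computed from two of them by programs that are small in comparison
  with their indices. Let \<open>y\<^sub>i\<close> be the problem of producing a pair of a number \<open>m\<close> and a function that
  is not computed from any \<open>F \<langle>i, e\<rangle>\<close> by a program of size less than about \<open>e / m\<close>. Finite joins of
  the \<open>y\<^sub>i\<close> lie strictly below \<open>J\<close>, and the finite meets of such joins form a copy of the
  free distributive lattice on which the Medvedev implication is that of the upsets of a Boolean
  cube: to solve \<open>y\<^sub>i\<close> for \<open>i \<in> T - S\<close> from a reduction of \<open>\<Sum>\<^sub>T y\<^sub>i\<close> to \<open>\<Sum>\<^sub>S y\<^sub>i + Z\<close>, it suffices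
  to know one finite piece of input on which the reduction announces its bound \<open>m\<close>. Since \<open>J\<close> is
  join-prime, \<open>A\<close> behaves as the falsity of these lattices. Finally, a formula outside \<open>Jan\<close> fails in
  a finite frame with a greatest element, and the chains of that frame embed it into a cube, where
  everything that is not a chain is sent to the greatest element.\<close>

section \<open>Effective functionals\<close>

text \<open>The functions \<open>F d\<close> are finite modifications of \<open>f\<close>: only
  \<open>f\<close> is known to compute no element of \<open>J\<close>, so everything must stay below
  \<open>f\<close>. Hence all \<open>F d\<close> are Turing equivalent, and only the sizes of
  programs can tell them apart. Without a size restriction \<open>f\<close> itself would solve none
  of the problems. The cutoff \<open>e / (m + 1)\<close> leaves slack: composing with a program of
  size \<open>c\<close> costs a factor \<open>c\<close> in \<open>m\<close>, and \<open>f\<close>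
  becomes a solution once \<open>m\<close> is large. This is why \<open>m\<close> is part of a
  solution. The price is paid at the implication. A solver must announce its own bound before it
  knows anything about the functions from which its input might be computed, and the bound announced
  by the given reduction may depend on the whole input. Once a finite piece of input fixes the first
  output value, each \<open>F d\<close> has a version that starts with this piece, at a cost in
  program size that is known in advance. All size estimates are therefore explicit and
  computable.\<close>

definition effective :: "((nat \<Rightarrow> nat) \<Rightarrow> nat \<Rightarrow> nat) \<Rightarrow> bool" where
  "effective F \<longleftrightarrow> (\<exists>p. \<forall>f x. exec f p x = Some (F f x))"

definition decidable :: "((nat \<Rightarrow> nat) \<Rightarrow> nat \<Rightarrow> bool) \<Rightarrow> bool" where
  "decidable P \<longleftrightarrow> effective (\<lambda>f x. of_bool (P f x))"

abbreviation pair :: "nat \<Rightarrow> nat \<Rightarrow> nat" where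
  "pair a b \<equiv> prod_encode (a, b)"

abbreviation pi1 :: "nat \<Rightarrow> nat" where
  "pi1 x \<equiv> fst (prod_decode x)"

abbreviation pi2 :: "nat \<Rightarrow> nat" where
  "pi2 x \<equiv> snd (prod_decode x)"

lemma effectiveI: "(\<And>f x. exec f p x = Some (F f x)) \<Longrightarrow> effective F"
  unfolding effective_def by blast

lemma effective_id: "effective (\<lambda>f x. x)"
  by (rule effectiveI[of "Pair Left Right"]) simp

lemma effective_Suc: "effective A \<Longrightarrow> effective (\<lambda>f x. Suc (A f x))"
  unfolding effective_def by (elim exE, rename_tac p, rule_tac x = "Comp Succ p" in exI) simp

lemma effective_pi1: "effective A \<Longrightarrow> effective (\<lambda>f x. pi1 (A f x))"
  unfolding effective_def by (elim exE, rename_tac p, rule_tac x = "Comp Left p" in exI) simp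

lemma effective_pi2: "effective A \<Longrightarrow> effective (\<lambda>f x. pi2 (A f x))"
  unfolding effective_def by (elim exE, rename_tac p, rule_tac x = "Comp Right p" in exI) simp

lemma effective_oracle: "effective A \<Longrightarrow> effective (\<lambda>f x. f (A f x))"
  unfolding effective_def by (elim exE, rename_tac p, rule_tac x = "Comp Oracle p" in exI) simp

lemma effective_pair:
  "effective A \<Longrightarrow> effective B \<Longrightarrow> effective (\<lambda>f x. pair (A f x) (B f x))"
  unfolding effective_def
  by (elim exE, rename_tac p q, rule_tac x = "Pair p q" in exI) simp

lemma effective_compose:
  "effective A \<Longrightarrow> effective B \<Longrightarrow> effective (\<lambda>f x. A f (B f x))"
  unfolding effective_def
  by (elim exE, rename_tac p q, rule_tac x = "Comp p q" in exI) simp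

lemma effective_compose2:
  assumes "effective (\<lambda>f w. H f (pi1 w) (pi2 w))" "effective A" "effective B"
  shows "effective (\<lambda>f x. H f (A f x) (B f x))"
  using effective_compose[OF assms(1) effective_pair[OF assms(2,3)]] by simp

lemma effective_const: "effective (\<lambda>f x. c)"
proof (induction c)
  case 0
  show ?case by (rule effectiveI[of Zero]) simp
next
  case (Suc c)
  then show ?case by (rule effective_Suc)
qed

text \<open>\<open>Prec\<close> carries its parameter unchanged; with \<open>x\<close> itself as
  that parameter, both the base and the step may refer to \<open>x\<close>.\<close>

lemma effective_rec_nat:
  assumes A: "effective A" and N: "effective N"
    and Q: "effective (\<lambda>f w. Q f (pi1 w) (pi1 (pi2 w)) (pi2 (pi2 w)))"
  shows "effective (\<lambda>f x. rec_nat (A f x) (\<lambda>m y. Q f x m y) (N f x))"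
proof -
  obtain p q where p: "exec f p x = Some (A f x)"
    and q: "exec f q x = Some (Q f (pi1 x) (pi1 (pi2 x)) (pi2 (pi2 x)))" for f x
    using A Q unfolding effective_def by blast
  have *: "rec_nat (exec f p a) (\<lambda>m r. Option.bind r (\<lambda>y. exec f q (pair a (pair m y)))) n
     = Some (rec_nat (A f a) (\<lambda>m y. Q f a m y) n)" for f a n
    by (induction n) (simp_all add: p q)
  have "effective (\<lambda>f w. rec_nat (A f (pi1 w)) (\<lambda>m y. Q f (pi1 w) m y) (pi2 w))"
    by (rule effectiveI[of "Prec p q"]) (simp add: * split_beta)
  from effective_compose2[OF this effective_id N] show ?thesis .
qed

section \<open>Arithmetic and bounded quantifiers for effective functionals\<close>

lemma effective_add:
  assumes "effective A" "effective B" shows "effective (\<lambda>f x. A f x + B f x)"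
proof -
  have "effective (\<lambda>f x. rec_nat (A f x) (\<lambda>m y. Suc y) (B f x))"
    by (intro effective_rec_nat assms effective_Suc effective_pi2 effective_id)
  moreover have "rec_nat a (\<lambda>m y. Suc y) b = a + b" for a b :: nat
    by (induction b) simp_all
  ultimately show ?thesis by simp
qed

lemma effective_mult:
  assumes "effective A" "effective B" shows "effective (\<lambda>f x. A f x * B f x)"
proof -
  have "effective (\<lambda>f x. rec_nat 0 (\<lambda>m y. A f x + y) (B f x))"
    by (intro effective_rec_nat effective_add effective_compose[OF assms(1)] effective_const assms
        effective_pi2 effective_pi1 effective_id)
  moreover have "rec_nat 0 (\<lambda>m y. a + y) b = a * b" for a b :: nat
    by (induction b) simp_all
  ultimately show ?thesis by simp
qed

lemma effective_diff:
  assumes "effective A" "effective B" shows "effective (\<lambda>f x. A f x - B f x)"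
proof -
  have pred: "effective (\<lambda>f x. A f x - 1)" if "effective A" for A
  proof -
    have "effective (\<lambda>f x. rec_nat 0 (\<lambda>m y. m) (A f x))"
      by (intro effective_rec_nat that effective_const effective_pi1 effective_pi2 effective_id)
    moreover have "rec_nat 0 (\<lambda>m y. m) b = b - 1" for b :: nat
      by (cases b) simp_all
    ultimately show ?thesis by simp
  qed
  have "effective (\<lambda>f x. rec_nat (A f x) (\<lambda>m y. y - 1) (B f x))"
    by (intro effective_rec_nat assms pred effective_pi2 effective_id)
  moreover have "rec_nat a (\<lambda>m y. y - 1) b = a - b" for a b :: nat
    by (induction b) simp_all
  ultimately show ?thesis by simp
qed

lemma decidable_eq_0:
  assumes "effective A" shows "decidable (\<lambda>f x. A f x = 0)"
proof -
  have "effective (\<lambda>f x. 1 - A f x)" by (rule effective_diff[OF effective_const assms])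
  moreover have "(\<lambda>f x. 1 - A f x) = (\<lambda>f x. of_bool (A f x = 0))" by (auto simp: fun_eq_iff)
  ultimately show ?thesis unfolding decidable_def by (rule back_subst)
qed

lemma decidable_less:
  assumes "effective A" "effective B" shows "decidable (\<lambda>f x. A f x < B f x)"
proof -
  have "decidable (\<lambda>f x. Suc (A f x) - B f x = 0)"
    by (rule decidable_eq_0[OF effective_diff[OF effective_Suc[OF assms(1)] assms(2)]])
  moreover have "(\<lambda>f x. Suc (A f x) - B f x = 0) = (\<lambda>f x. A f x < B f x)"
    by (auto simp: fun_eq_iff)
  ultimately show ?thesis by (rule back_subst)
qed

lemma decidable_not: "decidable P \<Longrightarrow> decidable (\<lambda>f x. \<not> P f x)"
proof -
  assume "decidable P"
  then have "decidable (\<lambda>f x. of_bool (P f x) = (0::nat))"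
    unfolding decidable_def[of P] by (rule decidable_eq_0)
  then show ?thesis by simp
qed

lemma decidable_conj:
  assumes "decidable P" "decidable Q" shows "decidable (\<lambda>f x. P f x \<and> Q f x)"
proof -
  have "effective (\<lambda>f x. of_bool (P f x) * of_bool (Q f x))"
    using assms unfolding decidable_def by (rule effective_mult)
  then show ?thesis unfolding decidable_def by (simp only: of_bool_conj)
qed

lemma decidable_disj:
  assumes "decidable P" "decidable Q" shows "decidable (\<lambda>f x. P f x \<or> Q f x)"
proof -
  have "decidable (\<lambda>f x. \<not> (\<not> P f x \<and> \<not> Q f x))"
    by (intro decidable_not decidable_conj assms)
  then show ?thesis by simp
qed

lemma decidable_imp:
  assumes "decidable P" "decidable Q" shows "decidable (\<lambda>f x. P f x \<longrightarrow> Q f x)"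
  unfolding imp_conv_disj by (rule decidable_disj[OF decidable_not[OF assms(1)] assms(2)])

lemma decidable_le:
  assumes "effective A" "effective B" shows "decidable (\<lambda>f x. A f x \<le> B f x)"
  unfolding not_less[symmetric] by (rule decidable_not[OF decidable_less[OF assms(2,1)]])

lemma decidable_eq:
  assumes "effective A" "effective B" shows "decidable (\<lambda>f x. A f x = B f x)"
proof -
  have "decidable (\<lambda>f x. A f x \<le> B f x \<and> B f x \<le> A f x)"
    by (rule decidable_conj[OF decidable_le[OF assms] decidable_le[OF assms(2,1)]])
  moreover have "(\<lambda>f x. A f x \<le> B f x \<and> B f x \<le> A f x) = (\<lambda>f x. A f x = B f x)"
    by (auto simp: fun_eq_iff)
  ultimately show ?thesis by (rule back_subst)
qed

lemma effective_if:
  assumes "decidable P" "effective A" "effective B"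
  shows "effective (\<lambda>f x. if P f x then A f x else B f x)"
proof -
  have "effective (\<lambda>f x. of_bool (P f x) * A f x + of_bool (\<not> P f x) * B f x)"
    using assms decidable_not[OF assms(1)] unfolding decidable_def
    by (intro effective_add effective_mult)
  moreover have "of_bool Q * a + of_bool (\<not> Q) * b = (if Q then a else b)" for Q and a b :: nat
    by simp
  ultimately show ?thesis by simp
qed

lemma decidable_compose:
  "decidable P \<Longrightarrow> effective B \<Longrightarrow> decidable (\<lambda>f x. P f (B f x))"
  unfolding decidable_def by (rule effective_compose)

lemma decidable_ex_less:
  assumes P: "decidable (\<lambda>f w. P f (pi1 w) (pi2 w))" and N: "effective N"
  shows "decidable (\<lambda>f x. \<exists>j<N f x. P f x j)"
proof -
  have "effective (\<lambda>f x. rec_nat 0 (\<lambda>m y. if P f x m then 1 else y) (N f x))"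
    by (intro effective_rec_nat effective_if effective_const effective_pi2 effective_id N
        decidable_compose[OF P, of "\<lambda>f w. pair (pi1 w) (pi1 (pi2 w))", simplified]
        effective_pair effective_pi1)
  moreover have "rec_nat 0 (\<lambda>m y. if Q m then 1 else y) n = (of_bool (\<exists>j<n. Q j) :: nat)"
    for Q and n :: nat
    by (induction n) (auto simp: less_Suc_eq)
  ultimately show ?thesis unfolding decidable_def by (simp only:)
qed

lemma decidable_all_less:
  assumes P: "decidable (\<lambda>f w. P f (pi1 w) (pi2 w))" and N: "effective N"
  shows "decidable (\<lambda>f x. \<forall>j<N f x. P f x j)"
  using decidable_not[OF decidable_ex_less[OF decidable_not[OF P] N]] by simp

lemma effective_mod2: "effective A \<Longrightarrow> effective (\<lambda>f x. A f x mod 2)"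
proof -
  assume A: "effective A"
  have "effective (\<lambda>f x. rec_nat 0 (\<lambda>m y. 1 - y) (A f x))"
    by (intro effective_rec_nat A effective_const effective_diff effective_pi2 effective_id)
  moreover have "rec_nat 0 (\<lambda>m y. 1 - y) n = n mod 2" for n :: nat
    by (induction n) (auto simp: mod_Suc)
  ultimately show ?thesis by simp
qed

lemma effective_div2: "effective A \<Longrightarrow> effective (\<lambda>f x. A f x div 2)"
proof -
  assume A: "effective A"
  have "effective (\<lambda>f x. rec_nat 0 (\<lambda>m y. y + m mod 2) (A f x))"
    by (intro effective_rec_nat A effective_const effective_add effective_mod2 effective_pi1
        effective_pi2 effective_id)
  moreover have "rec_nat 0 (\<lambda>m y. y + m mod 2) n = n div 2" for n :: nat
  proof (induction n)
    case (Suc n)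
    have "Suc n div 2 = n div 2 + n mod 2" by presburger
    with Suc show ?case by simp
  qed simp
  ultimately show ?thesis by simp
qed

lemma decidable_even: "effective A \<Longrightarrow> decidable (\<lambda>f x. even (A f x))"
  using decidable_eq_0[OF effective_mod2[of A]] by (simp add: even_iff_mod_2_eq_zero)

lemma effective_div4: "effective A \<Longrightarrow> effective (\<lambda>f x. A f x div 4)"
  using effective_div2[OF effective_div2[of A]] by (simp add: div_mult2_eq[symmetric])

lemma effective_mod4: "effective A \<Longrightarrow> effective (\<lambda>f x. A f x mod 4)"
proof -
  assume "effective A"
  then have "effective (\<lambda>f x. A f x - 4 * (A f x div 4))"
    by (intro effective_diff effective_mult effective_const effective_div4)
  then show ?thesis by (simp only: minus_mult_div_eq_mod)
qed

lemma effective_case_nat: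
  assumes "effective A" "effective B" "effective (\<lambda>f w. C f (pi1 w) (pi2 w))"
  shows "effective (\<lambda>f x. case_nat (A f x) (C f x) (B f x))"
proof -
  have "effective (\<lambda>f x. if B f x = 0 then A f x else C f x (B f x - 1))"
    by (intro effective_if decidable_eq_0 assms effective_compose2[OF assms(3)] effective_id
        effective_diff effective_const)
  moreover have "(if b = 0 then a else c (b - 1)) = case_nat a c b" for a b :: nat and c
    by (cases b) simp_all
  ultimately show ?thesis by simp
qed

lemma effective_oplus:
  assumes "effective (\<lambda>f w. G f (pi1 w) (pi2 w))" "effective (\<lambda>f w. H f (pi1 w) (pi2 w))"
    "effective A"
  shows "effective (\<lambda>f x. (G f x \<oplus> H f x) (A f x))"
  unfolding oplus_def
  by (intro effective_if decidable_even effective_compose2[OF assms(1)]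
      effective_compose2[OF assms(2)] effective_div2 assms(3) effective_id)

text \<open>An arbitrary function on a finite set can be hard-wired into a program. This spares
  arithmetizing \<open>set_decode\<close> when codes of subsets of \<open>{..<n}\<close> are
  processed.\<close>

lemma effective_table:
  assumes "finite D" "effective A" shows "\<exists>G. (\<forall>x\<in>D. G x = T x) \<and> effective (\<lambda>f x. G (A f x))"
  using assms(1)
proof (induction rule: finite_induct)
  case empty
  show ?case using effective_const[of 0] by (intro exI[of _ "\<lambda>_. 0"]) simp
next
  case (insert d D)
  then obtain G where G: "\<forall>x\<in>D. G x = T x" "effective (\<lambda>f x. G (A f x))" by blast
  have "effective (\<lambda>f x. if A f x = d then T d else G (A f x))"
    by (intro effective_if decidable_eq G assms effective_const)
  with G(1) show ?case
    by (intro exI[of _ "\<lambda>x. if x = d then T d else G x"]) auto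
qed

lemmas effective_intros =
  effective_id effective_const effective_Suc effective_pi1 effective_pi2 effective_oracle
  effective_pair effective_add effective_mult effective_diff effective_if effective_div2
  effective_mod2 effective_div4 effective_mod4 effective_case_nat effective_oplus
  decidable_eq decidable_less decidable_le decidable_not decidable_conj decidable_disj
  decidable_imp decidable_ex_less decidable_all_less decidable_even

section \<open>From effective functionals to programs; unbounded search\<close>

lemma functionalI: "(\<And>n. exec f p n = Some (g n)) \<Longrightarrow> functional p f = Some g"
  by (auto simp: functional_def)

lemma functional_of_effective:
  assumes "effective F" shows "\<exists>p. \<forall>f. functional p f = Some (F f)"
  using assms unfolding effective_def by (meson functionalI)

text \<open>The test is total, so \<open>Mn\<close> cannot get stuck before the first witness.
  Partiality enters only through oracles and inputs without a witness.\<close>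

lemma search:
  assumes P: "decidable (\<lambda>f w. P f (pi1 w) (pi2 w))" and G: "effective (\<lambda>f w. G f (pi1 w) (pi2 w))"
  shows "\<exists>p. \<forall>f x. (\<exists>n. P f x n) \<longrightarrow> (\<exists>n. P f x n \<and> exec f p x = Some (G f x n))"
proof -
  obtain p q where p: "exec f p w = Some (of_bool (\<not> P f (pi1 w) (pi2 w)))"
    and q: "exec f q w = Some (G f (pi1 w) (pi2 w))" for f w
    using decidable_not[OF P] G unfolding effective_def decidable_def by blast
  show ?thesis
  proof (intro exI[of _ "Comp q (Pair (Pair Left Right) (Mn p))"] allI impI)
    fix f x assume ex: "\<exists>n. P f x n"
    let ?n = "LEAST n. P f x n"
    have "exec f p (pair x n) = Some 0 \<longleftrightarrow> P f x n" for n by (simp add: p)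
    then have "exec f (Mn p) x = Some ?n" using ex by (simp add: p)
    moreover have "P f x ?n" using ex by (rule LeastI_ex)
    ultimately show "\<exists>n. P f x n \<and> exec f (Comp q (Pair (Pair Left Right) (Mn p))) x = Some (G f x n)"
      by (intro exI[of _ ?n]) (simp add: q del: exec.simps(9))
  qed
qed

section \<open>Certified computations and the universal functional\<close>

text \<open>No length is stored: every number codes an infinite sequence, so \<open>seq c\<close>
  can directly serve as an oracle of which only a finite prefix is meant.\<close>

definition seq :: "nat \<Rightarrow> nat \<Rightarrow> nat" where
  "seq c k = pi1 (rec_nat c (\<lambda>_ y. pi2 y) k)"

lemma seq_pair_0: "seq (pair a c) 0 = a"
  by (simp add: seq_def)

lemma seq_pair_Suc: "seq (pair a c) (Suc k) = seq c k"
proof -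
  have "rec_nat (pair a c) (\<lambda>_ y. pi2 y) (Suc k) = rec_nat c (\<lambda>_ y. pi2 y) k"
    by (induction k) simp_all
  then show ?thesis by (simp only: seq_def)
qed

lemma ex_seq: "\<exists>c. \<forall>k<n. seq c k = h k"
proof (induction n arbitrary: h)
  case (Suc n)
  from Suc[of "\<lambda>k. h (Suc k)"] obtain c where c: "\<forall>k<n. seq c k = h (Suc k)" by blast
  have "seq (pair (h 0) c) k = h k" if "k < Suc n" for k
    using that c by (cases k) (simp_all add: seq_pair_0 seq_pair_Suc)
  then show ?case by blast
qed simp

lemma effective_seq:
  assumes "effective A" "effective B" shows "effective (\<lambda>f x. seq (A f x) (B f x))"
  unfolding seq_def by (intro effective_pi1 effective_rec_nat assms effective_pi2 effective_id)

lemma decidable_if: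
  assumes "decidable P" "decidable Q" "decidable R"
  shows "decidable (\<lambda>f x. if P f x then Q f x else R f x)"
  unfolding if_bool_eq_conj by (intro decidable_conj decidable_imp decidable_not assms)

lemma decidable_compose2:
  assumes "decidable (\<lambda>f w. P f (pi1 w) (pi2 w))" "effective A" "effective B"
  shows "decidable (\<lambda>f x. P f (A f x) (B f x))"
  using decidable_compose[OF assms(1) effective_pair[OF assms(2,3)]] by simp

abbreviation triple :: "nat \<Rightarrow> nat \<Rightarrow> nat \<Rightarrow> nat" where
  "triple e x y \<equiv> pair e (pair x y)"

text \<open>\<open>S\<close> is the set of already established facts \<open>triple e x y\<close>, read as: program \<open>e\<close> maps
  \<open>x\<close> to \<open>y\<close>. The number \<open>s\<close> bounds both the oracle queries and the intermediate values.\<close>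

definition justified ::
  "(nat \<Rightarrow> nat) \<Rightarrow> nat \<Rightarrow> (nat \<Rightarrow> bool) \<Rightarrow> nat \<Rightarrow> nat \<Rightarrow> nat \<Rightarrow> bool" where
  "justified h s S e x y \<longleftrightarrow>
    (if e = 0 then y = 0 else if e = 1 then y = Suc x else if e = 2 then y = pi1 x
     else if e = 3 then y = pi2 x else if e = 4 then x < s \<and> y = h x
     else if (e - 5) mod 4 = 0 then
       S (triple (pi1 ((e - 5) div 4)) x (pi1 y)) \<and> S (triple (pi2 ((e - 5) div 4)) x (pi2 y))
     else if (e - 5) mod 4 = 1 then
       \<exists>u<s. S (triple (pi2 ((e - 5) div 4)) x u) \<and> S (triple (pi1 ((e - 5) div 4)) u y)
     else if (e - 5) mod 4 = 2 then
       if pi2 x = 0 then S (triple (pi1 ((e - 5) div 4)) (pi1 x) y)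
       else \<exists>u<s. S (triple e (pair (pi1 x) (pi2 x - 1)) u) \<and>
         S (triple (pi2 ((e - 5) div 4)) (pair (pi1 x) (pair (pi2 x - 1) u)) y)
     else S (triple ((e - 5) div 4) (pair x y) 0) \<and>
       (\<forall>m<y. \<exists>u<s. u \<noteq> 0 \<and> S (triple ((e - 5) div 4) (pair x m) u)))"

definition justified_entry :: "(nat \<Rightarrow> nat) \<Rightarrow> nat \<Rightarrow> (nat \<Rightarrow> bool) \<Rightarrow> nat \<Rightarrow> bool" where
  "justified_entry h s S w = justified h s S (pi1 w) (pi1 (pi2 w)) (pi2 (pi2 w))"

text \<open>The certificate \<open>t\<close> is \<open>pair c (pair l s)\<close>: \<open>l\<close>
  facts coded by \<open>c\<close>, each justified by earlier ones, and the common bound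
  \<open>s\<close>. All quantifiers are bounded, which makes the relation decidable although halting
  is not.\<close>

definition certifies :: "(nat \<Rightarrow> nat) \<Rightarrow> nat \<Rightarrow> nat \<Rightarrow> nat \<Rightarrow> nat \<Rightarrow> bool" where
  "certifies h t e x y \<longleftrightarrow>
    (\<forall>i<pi1 (pi2 t). justified_entry h (pi2 (pi2 t)) (\<lambda>w. \<exists>j<i. seq (pi1 t) j = w) (seq (pi1 t) i)) \<and>
    (\<exists>i<pi1 (pi2 t). seq (pi1 t) i = triple e x y)"

abbreviation use_bound :: "nat \<Rightarrow> nat" where
  "use_bound t \<equiv> pi2 (pi2 t)"

lemma decidable_justified_entry:
  assumes H: "effective (\<lambda>f w. H f (pi1 w) (pi2 w))"
    and S: "decidable (\<lambda>f w. S f (pi1 w) (pi2 w))"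
    and "effective V" "effective N" "effective W"
  shows "decidable (\<lambda>f x. justified_entry (H f (V f x)) (N f x) (S f (V f x)) (W f x))"
proof -
  have "decidable (\<lambda>f w. justified_entry (H f (pi1 w)) (pi1 (pi2 w)) (S f (pi1 w)) (pi2 (pi2 w)))"
    unfolding justified_entry_def justified_def
    by (intro decidable_if effective_intros decidable_compose2[OF S] effective_compose2[OF H])
  from decidable_compose[OF this effective_pair[OF assms(3) effective_pair[OF assms(4,5)]]]
  show ?thesis by simp
qed

text \<open>The simulated oracle \<open>H f v\<close> may depend on a number \<open>v\<close>, so
  that searches can range over finite pieces of an oracle.\<close>

lemma decidable_certifies:
  assumes H: "effective (\<lambda>f w. H f (pi1 w) (pi2 w))"
    and *: "effective V" "effective T" "effective E" "effective X" "effective Y"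
  shows "decidable (\<lambda>f x. certifies (H f (V f x)) (T f x) (E f x) (X f x) (Y f x))"
proof -
  \<comment> \<open>The number \<open>v\<close> packs three things as
    \<open>pair v0 (pair c i)\<close>: the parameter of the oracle, the code of the list of facts,
    and the position before which premises must occur.\<close>
  have 1: "effective (\<lambda>f w. (\<lambda>f v. H f (pi1 v)) f (pi1 w) (pi2 w))"
    by (intro effective_intros effective_compose2[OF H])
  have 2: "decidable (\<lambda>f w. (\<lambda>f v w. \<exists>j<pi2 (pi2 v). seq (pi1 (pi2 v)) j = w) f (pi1 w) (pi2 w))"
    by (intro effective_intros effective_seq)
  have "decidable (\<lambda>f w. certifies (H f (pi1 w)) (pi1 (pi2 w)) (pi1 (pi2 (pi2 w)))
     (pi1 (pi2 (pi2 (pi2 w)))) (pi2 (pi2 (pi2 (pi2 w)))))"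
    unfolding certifies_def
    by (intro effective_intros effective_seq decidable_justified_entry[OF 1 2,
         of "\<lambda>f x. pair (pi1 (pi1 x)) (pair (pi1 (pi1 (pi2 (pi1 x)))) (pi2 x))", simplified])
  from decidable_compose[OF this effective_pair[OF *(1) effective_pair[OF *(2)
        effective_pair[OF *(3) effective_pair[OF *(4,5)]]]]]
  show ?thesis by simp
qed

section \<open>The use principle and soundness of certificates\<close>

lemma justified_mono:
  assumes "justified h s S e x y" "s \<le> s'" "\<And>w. S w \<Longrightarrow> S' w"
  shows "justified h s' S' e x y"
  using assms unfolding justified_def by (auto split: if_splits) (meson less_le_trans)+

lemma justified_cong:
  assumes "\<forall>k<s. h' k = h k" shows "justified h' s S e x y = justified h s S e x y"
  using assms unfolding justified_def by auto

text \<open>The use principle: the oracle clause of \<open>justified\<close> accepts only queries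
  below the bound stored in \<open>t\<close>.\<close>

lemma certifies_cong:
  assumes "\<forall>k<use_bound t. h' k = h k" shows "certifies h' t e x y = certifies h t e x y"
  unfolding certifies_def justified_entry_def using justified_cong[OF assms] by simp

lemma exec_Prec:
  "exec h (Prec p q) (pair a 0) = exec h p a"
  "exec h (Prec p q) (pair a (Suc n)) =
     Option.bind (exec h (Prec p q) (pair a n)) (\<lambda>y. exec h q (pair a (pair n y)))"
  by simp_all

lemma exec_Mn_eq_Some:
  "exec h (Mn p) x = Some y \<longleftrightarrow>
     exec h p (pair x y) = Some 0 \<and> (\<forall>m<y. \<exists>u. u \<noteq> 0 \<and> exec h p (pair x m) = Some u)"
  (is "?L \<longleftrightarrow> ?R")
proof
  assume L: ?L
  let ?P = "\<lambda>n. exec h p (pair x n) = Some 0"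
  from L have ex: "\<exists>n. ?P n \<and> (\<forall>m<n. exec h p (pair x m) \<noteq> None)" and y: "y = (LEAST n. ?P n)"
    by (auto split: if_splits)
  then obtain n where n: "?P n" "\<forall>m<n. exec h p (pair x m) \<noteq> None" by blast
  have "?P y" "y \<le> n" using n(1) unfolding y by (rule LeastI, rule Least_le)
  moreover have "\<not> ?P m" if "m < y" for m using that not_less_Least unfolding y by blast
  ultimately show ?R using n(2) by (metis less_le_trans option.exhaust)
next
  assume R: ?R
  then have "(LEAST n. exec h p (pair x n) = Some 0) = y"
    by (intro Least_equality) (auto simp: not_less[symmetric])
  moreover have "\<exists>n. exec h p (pair x n) = Some 0 \<and> (\<forall>m<n. exec h p (pair x m) \<noteq> None)"
    using R by (intro exI[of _ y]) auto
  ultimately show ?L by simp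
qed

lemma prog_of_compound:
  assumes "\<not> e \<le> 4"
  shows "prog_of e = (if (e - 5) mod 4 = 0 then
       Pair (prog_of (pi1 ((e - 5) div 4))) (prog_of (pi2 ((e - 5) div 4)))
     else if (e - 5) mod 4 = 1 then
       Comp (prog_of (pi1 ((e - 5) div 4))) (prog_of (pi2 ((e - 5) div 4)))
     else if (e - 5) mod 4 = 2 then
       Prec (prog_of (pi1 ((e - 5) div 4))) (prog_of (pi2 ((e - 5) div 4)))
     else Mn (prog_of ((e - 5) div 4)))"
  using assms by (simp add: Let_def prog_of.simps[of e])

lemma prog_of_base:
  "prog_of 0 = Zero" "prog_of 1 = Succ" "prog_of 2 = Left" "prog_of 3 = Right" "prog_of 4 = Oracle"
  by (simp_all add: prog_of.simps)

lemma justified_sound: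
  assumes J: "justified h s S e x y"
    and S: "\<And>e x y. S (triple e x y) \<Longrightarrow> exec h (prog_of e) x = Some y"
  shows "exec h (prog_of e) x = Some y"
proof (cases "e \<le> 4")
  case True
  then consider "e = 0" | "e = 1" | "e = 2" | "e = 3" | "e = 4" by linarith
  then show ?thesis using J prog_of_base by cases (simp_all add: justified_def)
next
  case False
  let ?k = "(e - 5) div 4"
  have ne: "e \<noteq> 0" "e \<noteq> 1" "e \<noteq> 2" "e \<noteq> 3" "e \<noteq> 4" using False by auto
  note P = prog_of_compound[OF False]
  consider "(e - 5) mod 4 = 0" | "(e - 5) mod 4 = 1" | "(e - 5) mod 4 = 2" | "(e - 5) mod 4 = 3"
    by linarith
  then show ?thesis
  proof cases
    case 1
    then have "S (triple (pi1 ?k) x (pi1 y))" "S (triple (pi2 ?k) x (pi2 y))"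
      using J ne by (simp_all add: justified_def)
    from this[THEN S] show ?thesis using P 1 by simp
  next
    case 2
    then show ?thesis using J P ne by (auto simp add: justified_def S)
  next
    case 3
    then have P: "prog_of e = Prec (prog_of (pi1 ?k)) (prog_of (pi2 ?k))" using P by simp
    obtain a n where x: "x = pair a n" by (metis prod_decode_inverse surj_pair)
    show ?thesis
    proof (cases n)
      case 0
      then show ?thesis using J ne 3 by (auto simp: justified_def P x exec_Prec S simp del: exec.simps)
    next
      case (Suc n')
      with J ne 3 obtain u where "S (triple e (pair a n') u)"
        "S (triple (pi2 ?k) (pair a (pair n' u)) y)"
        by (auto simp: justified_def x)
      from this[THEN S] show ?thesis unfolding x Suc P exec_Prec by simp
    qed
  next
    case 4
    then have P: "prog_of e = Mn (prog_of ?k)" using P by simp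
    from J ne 4 have "S (triple ?k (pair x y) 0)" "\<forall>m<y. \<exists>u<s. u \<noteq> 0 \<and> S (triple ?k (pair x m) u)"
      by (auto simp: justified_def)
    then show ?thesis unfolding P exec_Mn_eq_Some using S by blast
  qed
qed

lemma certifies_sound:
  assumes "certifies h t e x y" shows "exec h (prog_of e) x = Some y"
proof -
  let ?v = "seq (pi1 t)"
  have "exec h (prog_of (pi1 (?v i))) (pi1 (pi2 (?v i))) = Some (pi2 (pi2 (?v i)))"
    if "i < pi1 (pi2 t)" for i
    using that
  proof (induction i rule: less_induct)
    case (less i)
    have "justified_entry h (pi2 (pi2 t)) (\<lambda>w. \<exists>j<i. ?v j = w) (?v i)"
      using assms less.prems unfolding certifies_def by blast
    then show ?case
      unfolding justified_entry_def
      by (rule justified_sound) (metis less fst_conv snd_conv less_trans prod_encode_inverse)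
  qed
  moreover obtain i where "i < pi1 (pi2 t)" "?v i = triple e x y"
    using assms unfolding certifies_def by blast
  ultimately show ?thesis by fastforce
qed

section \<open>Completeness of certificates\<close>

definition table :: "(nat \<Rightarrow> nat) \<Rightarrow> nat \<Rightarrow> nat list \<Rightarrow> bool" where
  "table h s ws \<longleftrightarrow> (\<forall>i<length ws. justified_entry h s (\<lambda>w. w \<in> set (take i ws)) (ws ! i))"

definition derivable :: "(nat \<Rightarrow> nat) \<Rightarrow> nat \<Rightarrow> bool" where
  "derivable h w \<longleftrightarrow> (\<exists>s ws. table h s ws \<and> w \<in> set ws)"

lemma justified_entry_mono:
  assumes "justified_entry h s S w" "s \<le> s'" "\<And>w. S w \<Longrightarrow> S' w"
  shows "justified_entry h s' S' w"
  using assms justified_mono unfolding justified_entry_def by blast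

text \<open>Concatenation is the reason for working with lists before coding them: premises still
  precede their conclusions, and enlarging the bound does no harm.\<close>

lemma table_append:
  assumes "table h s us" "table h s' vs" shows "table h (max s s') (us @ vs)"
  unfolding table_def
proof (intro allI impI)
  fix i assume i: "i < length (us @ vs)"
  show "justified_entry h (max s s') (\<lambda>w. w \<in> set (take i (us @ vs))) ((us @ vs) ! i)"
  proof (cases "i < length us")
    case True
    then have "justified_entry h s (\<lambda>w. w \<in> set (take i us)) (us ! i)"
      using assms(1) unfolding table_def by blast
    then show ?thesis using True by (auto simp: nth_append elim!: justified_entry_mono)
  next
    case False
    then have "justified_entry h s' (\<lambda>w. w \<in> set (take (i - length us) vs)) (vs ! (i - length us))"
      using assms(2) i unfolding table_def by auto
    then show ?thesis using False by (auto simp: nth_append elim!: justified_entry_mono)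
  qed
qed

lemma table_of_finite:
  assumes "finite D" "\<forall>w\<in>D. derivable h w" shows "\<exists>s ws. table h s ws \<and> D \<subseteq> set ws"
  using assms
proof (induction rule: finite_induct)
  case empty
  show ?case by (intro exI[of _ 0] exI[of _ "[]"]) (simp add: table_def)
next
  case (insert w D)
  then obtain s ws s' ws' where "table h s ws" "D \<subseteq> set ws" "table h s' ws'" "w \<in> set ws'"
    unfolding derivable_def by blast
  then show ?case using table_append[of h s ws s' ws'] by (metis (no_types, lifting) Un_iff insert_subset set_append subset_iff)
qed

lemma derivableI:
  assumes "finite D" "\<forall>w\<in>D. derivable h w" "justified h s (\<lambda>w. w \<in> D) e x y"
  shows "derivable h (triple e x y)"
proof -
  obtain s' ws where ws: "table h s' ws" "D \<subseteq> set ws" using table_of_finite[OF assms(1,2)] by blast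
  have "justified_entry h (max s s') (\<lambda>w. w \<in> set ws) (triple e x y)"
    using justified_mono[OF assms(3), of "max s s'" "\<lambda>w. w \<in> set ws"] ws(2)
    unfolding justified_entry_def by auto
  then have "table h (max s s') (ws @ [triple e x y])"
    using ws(1) unfolding table_def
    by (auto simp: nth_append less_Suc_eq intro: justified_entry_mono[OF _ max.cobounded2])
  then show ?thesis unfolding derivable_def by (meson in_set_conv_decomp)
qed

text \<open>Components of a program have smaller codes, so the induction is on \<open>e\<close>.
  Only primitive recursion cites facts about \<open>e\<close> itself, which calls for an inner
  induction on the recursion argument.\<close>

lemma derivable_complete:
  "exec h (prog_of e) x = Some y \<Longrightarrow> derivable h (triple e x y)"
proof (induction e arbitrary: x y rule: less_induct)
  case (less e)
  show ?case
  proof (cases "e \<le> 4")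
    case True
    then consider "e = 0" | "e = 1" | "e = 2" | "e = 3" | "e = 4" by linarith
    then have "justified h (Suc x) (\<lambda>w. w \<in> {}) e x y"
      using less.prems prog_of_base by cases (simp_all add: justified_def)
    from derivableI[OF _ _ this] show ?thesis by simp
  next
    case False
    let ?k = "(e - 5) div 4"
    have ne: "e \<noteq> 0" "e \<noteq> 1" "e \<noteq> 2" "e \<noteq> 3" "e \<noteq> 4" using False by auto
    have k: "?k < e" "pi1 ?k < e" "pi2 ?k < e"
      using False prod_decode_le[of ?k] div_le_dividend[of "e - 5" 4] by linarith+
    note P = prog_of_compound[OF False]
    consider "(e - 5) mod 4 = 0" | "(e - 5) mod 4 = 1" | "(e - 5) mod 4 = 2" | "(e - 5) mod 4 = 3"
      by linarith
    then show ?thesis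
    proof cases
      case 1
      then obtain a b where "exec h (prog_of (pi1 ?k)) x = Some a"
        "exec h (prog_of (pi2 ?k)) x = Some b" "y = pair a b"
        using less.prems P by (auto simp: bind_eq_Some_conv)
      then show ?thesis using 1 ne k less.IH
        by (intro derivableI[of "{triple (pi1 ?k) x a, triple (pi2 ?k) x b}" _ 0])
          (auto simp: justified_def)
    next
      case 2
      then obtain u where "exec h (prog_of (pi2 ?k)) x = Some u"
        "exec h (prog_of (pi1 ?k)) u = Some y"
        using less.prems P by (auto simp: bind_eq_Some_conv)
      then show ?thesis using 2 ne k less.IH
        by (intro derivableI[of "{triple (pi2 ?k) x u, triple (pi1 ?k) u y}" _ "Suc u"])
          (auto simp: justified_def)
    next
      case 3
      then have P: "prog_of e = Prec (prog_of (pi1 ?k)) (prog_of (pi2 ?k))" using P by simp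
      obtain a n where x: "x = pair a n" by (metis prod_decode_inverse surj_pair)
      have "exec h (prog_of e) (pair a n) = Some y \<Longrightarrow> derivable h (triple e (pair a n) y)"
      proof (induction n arbitrary: y)
        case 0
        then have "exec h (prog_of (pi1 ?k)) a = Some y" unfolding P exec_Prec .
        then show ?case using 3 ne k less.IH
          by (intro derivableI[of "{triple (pi1 ?k) a y}" _ 0]) (auto simp: justified_def)
      next
        case (Suc n)
        then obtain u where "exec h (prog_of e) (pair a n) = Some u"
          "exec h (prog_of (pi2 ?k)) (pair a (pair n u)) = Some y"
          unfolding P exec_Prec by (auto simp: bind_eq_Some_conv)
        then show ?case using 3 ne k less.IH Suc.IH
          by (intro derivableI[of "{triple e (pair a n) u, triple (pi2 ?k) (pair a (pair n u)) y}" _ "Suc u"])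
            (auto simp: justified_def)
      qed
      then show ?thesis using less.prems x by simp
    next
      case 4
      then have "prog_of e = Mn (prog_of ?k)" using P by simp
      then have "exec h (Mn (prog_of ?k)) x = Some y" using less.prems by (simp only:)
      then have *: "exec h (prog_of ?k) (pair x y) = Some 0"
        "\<forall>m<y. \<exists>u. u \<noteq> 0 \<and> exec h (prog_of ?k) (pair x m) = Some u"
        unfolding exec_Mn_eq_Some by (rule conjunct1, rule conjunct2)
      from *(2) obtain u where u: "\<forall>m<y. u m \<noteq> 0 \<and> exec h (prog_of ?k) (pair x m) = Some (u m)"
        by metis
      \<comment> \<open>The sum gives one strict bound for all the nonzero values met during the
        search.\<close>
      have bound: "u m < Suc (\<Sum>m<y. u m)" if "m < y" for m
        using that by (simp add: less_Suc_eq_le member_le_sum)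
      show ?thesis
        using 4 ne k less.IH *(1) u bound
        by (intro derivableI[of "insert (triple ?k (pair x y) 0) ((\<lambda>m. triple ?k (pair x m) (u m)) ` {..<y})"
              _ "Suc (\<Sum>m<y. u m)"])
          (auto simp: justified_def, blast)
    qed
  qed
qed

lemma certifies_complete:
  assumes "exec h (prog_of e) x = Some y" shows "\<exists>t. certifies h t e x y"
proof -
  obtain s ws where ws: "table h s ws" "triple e x y \<in> set ws"
    using derivable_complete[OF assms] unfolding derivable_def by blast
  obtain c where c: "\<forall>i<length ws. seq c i = ws ! i"
    using ex_seq[of "length ws" "\<lambda>i. ws ! i"] by blast
  have "justified_entry h s (\<lambda>w. \<exists>j<i. seq c j = w) (seq c i)" if "i < length ws" for i
  proof -
    have "justified_entry h s (\<lambda>w. w \<in> set (take i ws)) (ws ! i)"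
      using that ws(1) unfolding table_def by blast
    then show ?thesis using that c by (auto simp: in_set_conv_nth elim!: justified_entry_mono)
  qed
  moreover have "\<exists>i<length ws. seq c i = triple e x y" using ws(2) c by (auto simp: in_set_conv_nth)
  ultimately have "certifies h (pair c (pair (length ws) s)) e x y"
    unfolding certifies_def by simp
  then show ?thesis ..
qed

text \<open>Search for a certificate together with the value that it certifies; soundness makes any
  value found the right one. The index of the simulated program may itself be read off the
  oracle.\<close>

lemma universal:
  assumes H: "effective H" and N: "effective (\<lambda>f x. N f)"
  shows "\<exists>p. \<forall>f g. functional (prog_of (N f)) (H f) = Some g \<longrightarrow> functional p f = Some g"
proof -
  have "decidable (\<lambda>f w. certifies (H f) (pi1 (pi2 w)) (N f) (pi1 w) (pi2 (pi2 w)))"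
    by (intro decidable_certifies[of "\<lambda>f v. H f" "\<lambda>f x. 0"] effective_compose[OF H] N effective_intros)
  from search[OF this, of "\<lambda>f x n. pi2 n"] obtain p where
    p: "\<forall>f x. (\<exists>n. certifies (H f) (pi1 n) (N f) x (pi2 n)) \<longrightarrow>
      (\<exists>n. certifies (H f) (pi1 n) (N f) x (pi2 n) \<and> exec f p x = Some (pi2 n))"
    using effective_intros(5)[OF effective_intros(5)[OF effective_id]] by blast
  show ?thesis
  proof (intro exI[of _ p] allI impI functionalI)
    fix f g x assume g: "functional (prog_of (N f)) (H f) = Some g"
    then have x: "exec (H f) (prog_of (N f)) x = Some (g x)" by (rule functional_exec)
    from certifies_complete[OF this] have "\<exists>n. certifies (H f) (pi1 n) (N f) x (pi2 n)"
      by (metis fst_conv snd_conv prod_encode_inverse)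
    with p obtain n where "certifies (H f) (pi1 n) (N f) x (pi2 n)" "exec f p x = Some (pi2 n)"
      by blast
    with x show "exec f p x = Some (g x)" using certifies_sound by fastforce
  qed
qed

section \<open>The Medvedev lattice\<close>

lemma medvedev_leI:
  assumes "effective H" "\<And>f. f \<in> B \<Longrightarrow> H f \<in> A" shows "A \<le>\<^sub>M B"
  using functional_of_effective[OF assms(1)] assms(2) unfolding medvedev_le_def by metis

lemma medvedev_le_subset: "B \<subseteq> A \<Longrightarrow> A \<le>\<^sub>M B"
  by (rule medvedev_leI[of "\<lambda>f. f"]) (auto intro!: effective_intros)

lemma abs_le_abs: "abs_mdegree A \<le> abs_mdegree B \<longleftrightarrow> A \<le>\<^sub>M B"
  by (rule less_eq_mdegree.abs_eq)

lemma abs_rep: "abs_mdegree (rep_mdegree a) = a"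
  by (rule Quotient3_abs_rep[OF Quotient3_mdegree])

lemma rep_abs_le: "rep_mdegree (abs_mdegree A) \<le>\<^sub>M A" "A \<le>\<^sub>M rep_mdegree (abs_mdegree A)"
  by (simp_all add: abs_le_abs[symmetric] abs_rep)

lemma oplus_even [simp]: "(f \<oplus> g) (2 * n) = f n"
  and oplus_odd [simp]: "(f \<oplus> g) (Suc (2 * n)) = g n"
  by (simp_all add: oplus_def)

lemma medvedev_join_ge1: "A \<le>\<^sub>M mp_join A B"
  by (rule medvedev_leI[of "\<lambda>f x. f (2 * x)"]) (auto intro!: effective_intros simp: mp_join_def)

lemma medvedev_join_ge2: "B \<le>\<^sub>M mp_join A B"
  by (rule medvedev_leI[of "\<lambda>f x. f (Suc (2 * x))"]) (auto intro!: effective_intros simp: mp_join_def)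


text \<open>Fixing this program once and for all makes \<open>join_prog\<close> increase sizes by a
  constant only, which the later size estimates rely on.\<close>

definition oplus_prog :: "prog" where
  "oplus_prog = (SOME r. \<forall>f x. exec f r x =
     Some (if even (pi1 x) then pi1 (pi2 x) else pi2 (pi2 x)))"

definition half_prog :: "prog" where
  "half_prog = (SOME r. \<forall>f x. exec f r x = Some (x div 2))"

definition join_prog :: "prog \<Rightarrow> prog \<Rightarrow> prog" where
  "join_prog p q = Comp oplus_prog
     (Pair (Pair Left Right) (Pair (Comp p half_prog) (Comp q half_prog)))"

lemma functional_join_prog:
  assumes "functional p f = Some g" "functional q f = Some h"
  shows "functional (join_prog p q) f = Some (g \<oplus> h)"
proof -
  have "effective (\<lambda>f x. if even (pi1 x) then pi1 (pi2 x) else pi2 (pi2 x))"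
    by (intro effective_intros)
  then have "\<exists>r. \<forall>f x. exec f r x = Some (if even (pi1 x) then pi1 (pi2 x) else pi2 (pi2 x))"
    unfolding effective_def .
  from someI_ex[OF this] have 1: "exec f oplus_prog x =
     Some (if even (pi1 x) then pi1 (pi2 x) else pi2 (pi2 x))" for f x
    unfolding oplus_prog_def by blast
  have "effective (\<lambda>f x. x div 2)" by (intro effective_intros)
  then have "\<exists>r. \<forall>f x. exec f r x = Some (x div 2)" unfolding effective_def .
  from someI_ex[OF this] have 2: "exec f half_prog x = Some (x div 2)" for f x
    unfolding half_prog_def by blast
  show ?thesis
    by (rule functionalI)
      (simp add: join_prog_def 1 2 functional_exec[OF assms(1)] functional_exec[OF assms(2)] oplus_def)
qed

lemma medvedev_join_le:
  assumes "A \<le>\<^sub>M C" "B \<le>\<^sub>M C" shows "mp_join A B \<le>\<^sub>M C"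
proof -
  obtain p q where "\<forall>f\<in>C. \<exists>g\<in>A. functional p f = Some g" "\<forall>f\<in>C. \<exists>g\<in>B. functional q f = Some g"
    using assms unfolding medvedev_le_def by blast
  then have "\<forall>f\<in>C. \<exists>g\<in>mp_join A B. functional (join_prog p q) f = Some g"
    using functional_join_prog unfolding mp_join_def by fastforce
  then show ?thesis unfolding medvedev_le_def by blast
qed

lemma medvedev_meet_le1: "mp_meet A B \<le>\<^sub>M A"
  by (rule medvedev_leI[of "\<lambda>f. case_nat 0 f"])
    (auto intro!: effective_intros effective_case_nat[of "\<lambda>f x. 0" "\<lambda>f x. x" "\<lambda>f x. f", simplified]
      simp: mp_meet_def)

lemma medvedev_meet_le2: "mp_meet A B \<le>\<^sub>M B"
  by (rule medvedev_leI[of "\<lambda>f. case_nat 1 f"])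
    (auto intro!: effective_intros effective_case_nat[of "\<lambda>f x. 1" "\<lambda>f x. x" "\<lambda>f x. f", simplified]
      simp: mp_meet_def)

text \<open>Both programs run on the input stripped of its tag; the universal program serves to
  select one of them without running the other, which may diverge.\<close>

lemma medvedev_meet_ge:
  assumes "C \<le>\<^sub>M A" "C \<le>\<^sub>M B" shows "C \<le>\<^sub>M mp_meet A B"
proof -
  obtain p q where p: "\<forall>f\<in>A. \<exists>g\<in>C. functional p f = Some g"
    and q: "\<forall>f\<in>B. \<exists>g\<in>C. functional q f = Some g"
    using assms unfolding medvedev_le_def by blast
  obtain a b where ab: "prog_of a = p" "prog_of b = q" using surj_prog_of by (metis surjD)
  have "effective (\<lambda>f x. f (Suc x))" "effective (\<lambda>f x. if f 0 = 0 then a else b)"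
    by (intro effective_intros)+
  from universal[OF this] obtain u where u: "\<And>f g. functional (prog_of (if f 0 = 0 then a else b))
     (\<lambda>x. f (Suc x)) = Some g \<Longrightarrow> functional u f = Some g" by blast
  show ?thesis
    unfolding medvedev_le_def
  proof (intro exI[of _ u] ballI)
    fix f assume "f \<in> mp_meet A B"
    then consider h where "f = case_nat 0 h" "h \<in> A" | h where "f = case_nat 1 h" "h \<in> B"
      unfolding mp_meet_def by blast
    then show "\<exists>g\<in>C. functional u f = Some g"
    proof cases
      case 1
      with p obtain g where "g \<in> C" "functional p h = Some g" by blast
      then show ?thesis using u[of f g] 1(1) ab by auto
    next
      case 2
      with q obtain g where "g \<in> C" "functional q h = Some g" by blast
      then show ?thesis using u[of f g] 2(1) ab by auto
    qed
  qed
qed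

text \<open>In \<open>g \<oplus> case_nat z h\<close> the index \<open>z\<close> stands at position
  \<open>1\<close> and \<open>h\<close> on the odd positions from \<open>3\<close> on. So
  \<open>g \<oplus> h\<close> can be reassembled and program number \<open>z\<close> run on it by
  \<open>universal\<close>.\<close>

lemma medvedev_le_join_imp: "B \<le>\<^sub>M mp_join A (mp_imp A B)"
proof -
  have "effective (\<lambda>f x. ((\<lambda>x. f (2 * x)) \<oplus> (\<lambda>x. f (Suc (2 * Suc x)))) x)" "effective (\<lambda>f x. f 1)"
    by (intro effective_intros)+
  from universal[OF this] obtain u where u: "\<And>f g. functional (prog_of (f 1))
     ((\<lambda>x. f (2 * x)) \<oplus> (\<lambda>x. f (Suc (2 * Suc x)))) = Some g \<Longrightarrow> functional u f = Some g" by blast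
  show ?thesis
    unfolding medvedev_le_def
  proof (intro exI[of _ u] ballI)
    fix f assume "f \<in> mp_join A (mp_imp A B)"
    then obtain g z h where f: "f = g \<oplus> case_nat z h" "g \<in> A" "\<forall>g\<in>A. \<exists>h'\<in>B. Phi z (g \<oplus> h) = Some h'"
      unfolding mp_join_def mp_imp_def by blast
    then obtain k where k: "k \<in> B" "Phi z (g \<oplus> h) = Some k" by blast
    have "f (2 * x) = g x" "f (Suc (2 * Suc x)) = h x" "f 1 = z" for x
      unfolding f(1) by (simp_all only: oplus_even oplus_odd nat.case) (simp add: oplus_def)
    then show "\<exists>g\<in>B. functional u f = Some g"
      using u[of f k] k unfolding Phi_def by simp
  qed
qed

lemma medvedev_imp_le:
  assumes "B \<le>\<^sub>M mp_join A C" shows "mp_imp A B \<le>\<^sub>M C"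
proof -
  obtain p where p: "\<forall>f\<in>mp_join A C. \<exists>g\<in>B. functional p f = Some g"
    using assms unfolding medvedev_le_def by blast
  obtain z where z: "prog_of z = p" using surj_prog_of by (metis surjD)
  show ?thesis
  proof (rule medvedev_leI[of "\<lambda>f. case_nat z f"])
    show "effective (\<lambda>f. case_nat z f)"
      using effective_case_nat[of "\<lambda>f x. z" "\<lambda>f x. x" "\<lambda>f x. f"] by (auto intro!: effective_intros)
    fix f assume "f \<in> C"
    then have "\<forall>g\<in>A. \<exists>h\<in>B. Phi z (g \<oplus> f) = Some h"
      using p z unfolding mp_join_def Phi_def by blast
    then show "case_nat z f \<in> mp_imp A B" unfolding mp_imp_def by blast
  qed
qed

section \<open>Lattice laws and residuation for degrees\<close>

lemma mdegree_join_ge1: "a \<le> mdegree_join a b"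
  and mdegree_join_ge2: "b \<le> mdegree_join a b"
  unfolding mdegree_join_def
  by (metis abs_le_abs abs_rep medvedev_join_ge1) (metis abs_le_abs abs_rep medvedev_join_ge2)

lemma mdegree_join_le: "a \<le> c \<Longrightarrow> b \<le> c \<Longrightarrow> mdegree_join a b \<le> c"
  unfolding mdegree_join_def by (metis abs_le_abs abs_rep medvedev_join_le)

lemma mdegree_meet_le1: "mdegree_meet a b \<le> a"
  and mdegree_meet_le2: "mdegree_meet a b \<le> b"
  unfolding mdegree_meet_def
  by (metis abs_le_abs abs_rep medvedev_meet_le1) (metis abs_le_abs abs_rep medvedev_meet_le2)

lemma mdegree_meet_ge: "c \<le> a \<Longrightarrow> c \<le> b \<Longrightarrow> c \<le> mdegree_meet a b"
  unfolding mdegree_meet_def by (metis abs_le_abs abs_rep medvedev_meet_ge)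

lemma medvedev_join_mono: "A \<le>\<^sub>M A' \<Longrightarrow> B \<le>\<^sub>M B' \<Longrightarrow> mp_join A B \<le>\<^sub>M mp_join A' B'"
  by (meson medvedev_join_ge1 medvedev_join_ge2 medvedev_join_le medvedev_le_trans)

lemma mdegree_join_abs: "mdegree_join (abs_mdegree A) (abs_mdegree B) = abs_mdegree (mp_join A B)"
  unfolding mdegree_join_def
  by (intro antisym) (simp_all add: abs_le_abs medvedev_join_mono rep_abs_le)

text \<open>Residuation is all that is used about the implication from here on.\<close>

lemma mdegree_imp_le_iff: "mdegree_imp a b \<le> c \<longleftrightarrow> b \<le> mdegree_join a c"
proof
  assume "b \<le> mdegree_join a c"
  then have "rep_mdegree b \<le>\<^sub>M mp_join (rep_mdegree a) (rep_mdegree c)"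
    by (metis abs_le_abs abs_rep mdegree_join_def)
  from medvedev_imp_le[OF this] show "mdegree_imp a b \<le> c"
    unfolding mdegree_imp_def by (metis abs_le_abs abs_rep)
next
  assume *: "mdegree_imp a b \<le> c"
  have "b \<le> mdegree_join a (mdegree_imp a b)"
    using medvedev_le_join_imp[of "rep_mdegree b" "rep_mdegree a"]
      mdegree_join_abs[of "rep_mdegree a" "mp_imp (rep_mdegree a) (rep_mdegree b)"]
    unfolding mdegree_imp_def abs_rep by (metis abs_le_abs abs_rep)
  also have "\<dots> \<le> mdegree_join a c"
    using * by (meson mdegree_join_ge1 mdegree_join_ge2 mdegree_join_le order_trans)
  finally show "b \<le> mdegree_join a c" .
qed

lemma least_mdegree: "abs_mdegree UNIV \<le> a"
  by (metis abs_le_abs abs_rep medvedev_le_subset subset_UNIV)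

text \<open>Residuation makes the lattice distributive, and in a distributive lattice join-irreducible
  elements are join-prime.\<close>

lemma join_prime:
  assumes J: "join_irreducible medvedev J" and le: "J \<le> mdegree_join a b"
  shows "J \<le> a \<or> J \<le> b"
proof -
  note lub = mdegree_join_ge1 mdegree_join_ge2 mdegree_join_le
  note glb = mdegree_meet_le1 mdegree_meet_le2 mdegree_meet_ge
  define a' b' where "a' = mdegree_meet J a" and "b' = mdegree_meet J b"
  have distrib: "mdegree_meet (mdegree_join x y) (mdegree_join x z) \<le> mdegree_join x (mdegree_meet y z)"
    for x y z
    by (meson glb mdegree_imp_le_iff order_refl order_trans)
  have comm: "mdegree_join x y \<le> mdegree_join y x" for x y by (meson lub)
  have "J \<le> mdegree_join a' J" by (rule lub)
  moreover have "J \<le> mdegree_join a' b"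
  proof -
    have "J \<le> mdegree_meet (mdegree_join b J) (mdegree_join b a)"
      using glb(3) lub(2) le comm[of a b] by (meson order_trans)
    then show ?thesis unfolding a'_def using distrib[of b J a] comm by (meson order_trans)
  qed
  ultimately have "J \<le> mdegree_join a' b'"
    unfolding b'_def using distrib[of a' J b] glb(3) by (meson order_trans)
  moreover have "a' \<le> J" "b' \<le> J" unfolding a'_def b'_def by (rule glb)+
  ultimately have "J = mdegree_join a' b'" using lub(3) by (meson antisym)
  with J have "\<not> (a' < J \<and> b' < J)" unfolding join_irreducible_def medvedev_def by auto
  then have "J \<le> a' \<or> J \<le> b'" using \<open>a' \<le> J\<close> \<open>b' \<le> J\<close> by (auto simp: less_mdegree_def)
  then show ?thesis unfolding a'_def b'_def using glb by (meson order_trans)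
qed

section \<open>Noncomputable functions and independence\<close>

text \<open>Recursion with access to the list of all earlier choices, for constructions in which
  each term has to react to its predecessors.\<close>

lemma course_of_values_choice:
  assumes "\<And>L. \<exists>y. P L y"
  shows "\<exists>F. \<forall>d. P (map F [0..<d]) (F d)"
proof -
  define G where "G L = (SOME y. P L y)" for L
  have G: "P L (G L)" for L unfolding G_def by (rule someI_ex[OF assms])
  define Ls where "Ls = rec_nat [] (\<lambda>_ L. L @ [G L])"
  have "Ls d = map (\<lambda>i. G (Ls i)) [0..<d]" for d
    by (induction d) (simp_all add: Ls_def)
  then have "P (map (\<lambda>i. G (Ls i)) [0..<d]) (G (Ls d))" for d using G by metis
  then show ?thesis by blast
qed

lemma computable_functional:
  assumes "computable f" "functional p f = Some g" shows "computable g"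
  using assms functional_oracle_subst unfolding computable_def by metis

lemma computable_of_effective:
  "computable f \<Longrightarrow> effective H \<Longrightarrow> computable (H f)"
  using functional_of_effective computable_functional by metis

text \<open>If every noncomputable \<open>f\<close> computed an element of \<open>J\<close>, then \<open>J\<close> would be below the join of
  two problems \<open>{t 0, t 2, \<dots>}\<close> and \<open>{t 1, t 3, \<dots>}\<close> not above \<open>J\<close>: diagonalize against the \<open>k\<close>-th
  program at \<open>t (2 * k)\<close> and \<open>t (2 * k + 1)\<close>, and let \<open>t d\<close> list programs that compute elements of
  \<open>J\<close> from the functions \<open>t j\<close> with \<open>j < d\<close>. Of any two terms, one can then be used with the help of
  the other.\<close>

lemma ex_noncomputable_not_above:
  assumes J: "join_irreducible medvedev J" and J0: "\<not> J \<le> zero_prime"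
  shows "\<exists>f. \<not> computable f \<and> \<not> J \<le> abs_mdegree {f}"
proof (rule ccontr)
  assume none: "\<not> (\<exists>f. \<not> computable f \<and> \<not> J \<le> abs_mdegree {f})"
  have all: "J \<le> abs_mdegree {f}" if "\<not> computable f" for f
  proof (rule ccontr)
    assume "\<not> J \<le> abs_mdegree {f}"
    with that have "\<exists>f. \<not> computable f \<and> \<not> J \<le> abs_mdegree {f}"
      by (intro exI[of _ f] conjI)
    with none show False by (rule notE)
  qed
  define R where "R = rep_mdegree J"
  have R: "J \<le> abs_mdegree X \<longleftrightarrow> R \<le>\<^sub>M X" for X
    unfolding R_def by (metis abs_le_abs abs_rep)
  \<comment> \<open>The next term has index \<open>length L\<close>. Halving this index lets the
    even terms, and likewise the odd ones, meet every program. The head records the index and the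
    programs chosen for all earlier terms.\<close>
  define P where "P L y \<longleftrightarrow>
    (\<exists>c f. (\<forall>j<length L. seq c j = snd (L ! j)) \<and> fst y = case_nat (pair (length L) c) f) \<and>
    \<not> (\<exists>g\<in>R. functional (prog_of (length L div 2)) (fst y) = Some g) \<and>
    (\<exists>g\<in>R. functional (prog_of (snd y)) (fst y) = Some g)"
    for L :: "((nat \<Rightarrow> nat) \<times> nat) list" and y
  have "\<exists>y. P L y" for L
  proof -
    obtain c where c: "\<forall>j<length L. seq c j = snd (L ! j)"
      using ex_seq[of "length L" "\<lambda>j. snd (L ! j)"] by blast
    let ?n = "pair (length L) c" and ?p = "prog_of (length L div 2)"
    have "effective (\<lambda>f. case_nat ?n f)"
      using effective_case_nat[of "\<lambda>f x. ?n" "\<lambda>f x. x" "\<lambda>f x. f"] by (auto intro!: effective_intros)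
    from functional_of_effective[OF this] obtain s
      where s: "\<And>f. functional s f = Some (case_nat ?n f)" by blast
    have "\<not> R \<le>\<^sub>M {f. \<not> computable f}" using J0 R unfolding zero_prime_def by blast
    \<comment> \<open>The program that first attaches the head and then runs \<open>?p\<close> does
      not reduce \<open>J\<close> to \<open>zero_prime\<close>, so it fails at some noncomputable
      \<open>f\<close>.\<close>
    then obtain f where f: "\<not> computable f" "\<not> (\<exists>g\<in>R. functional (oracle_subst s ?p) f = Some g)"
      unfolding medvedev_le_def by blast
    have "{f} \<le>\<^sub>M {case_nat ?n f}"
      by (rule medvedev_leI[of "\<lambda>f x. f (Suc x)"]) (auto intro!: effective_intros)
    then have "R \<le>\<^sub>M {case_nat ?n f}" using all[OF f(1)] R medvedev_le_trans by blast
    then obtain q where "\<exists>g\<in>R. functional q (case_nat ?n f) = Some g"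
      unfolding medvedev_le_def by blast
    moreover obtain z where "prog_of z = q" using surj_prog_of by (metis surjD)
    ultimately have "P L (case_nat ?n f, z)"
      unfolding P_def fst_conv snd_conv using c f(2)[unfolded functional_oracle_subst[OF s]] by blast
    then show ?thesis by blast
  qed
  then obtain F where F: "P (map F [0..<d]) (F d)" for d
    using course_of_values_choice[of P] by blast
  define t q where "t d = fst (F d)" and "q d = snd (F d)" for d
  have t: "\<exists>c f. (\<forall>j<d. seq c j = q j) \<and> t d = case_nat (pair d c) f"
    and diag: "\<not> (\<exists>g\<in>R. functional (prog_of (d div 2)) (t d) = Some g)"
    and q: "\<exists>g\<in>R. functional (prog_of (q d)) (t d) = Some g" for d
    using F[of d] unfolding P_def t_def q_def by auto
  define X Y where "X = range (\<lambda>k. t (2 * k))" and "Y = range (\<lambda>k. t (Suc (2 * k)))"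
  have not_le: "\<not> R \<le>\<^sub>M X" "\<not> R \<le>\<^sub>M Y"
  proof -
    have *: "\<not> R \<le>\<^sub>M range (\<lambda>k. t (n k))" if n: "\<And>k. n k div 2 = k" for n
    proof
      assume "R \<le>\<^sub>M range (\<lambda>k. t (n k))"
      then obtain p where p: "\<forall>k. \<exists>g\<in>R. functional p (t (n k)) = Some g"
        unfolding medvedev_le_def by auto
      obtain k where "prog_of k = p" using surj_prog_of by (metis surjD)
      with p diag[of "n k"] show False by (simp add: n)
    qed
    show "\<not> R \<le>\<^sub>M X" "\<not> R \<le>\<^sub>M Y" unfolding X_def Y_def by (rule *; simp)+
  qed
  have "R \<le>\<^sub>M mp_join X Y"
  proof -
    \<comment> \<open>The heads, at \<open>h 0\<close> and \<open>h 1\<close>, show the two indices,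
      which differ in parity. The term of larger index lists a program for the term of smaller
      index, and that program is run.\<close>
    have "effective (\<lambda>h x. if pi1 (h 0) < pi1 (h 1) then h (2 * x) else h (Suc (2 * x)))"
      "effective (\<lambda>h x. if pi1 (h 0) < pi1 (h 1) then seq (pi2 (h 1)) (pi1 (h 0))
         else seq (pi2 (h 0)) (pi1 (h 1)))"
      by (intro effective_intros effective_seq)+
    from universal[OF this] obtain u where u: "\<And>h g. functional (prog_of
       (if pi1 (h 0) < pi1 (h 1) then seq (pi2 (h 1)) (pi1 (h 0)) else seq (pi2 (h 0)) (pi1 (h 1))))
       (\<lambda>x. if pi1 (h 0) < pi1 (h 1) then h (2 * x) else h (Suc (2 * x))) = Some g \<Longrightarrow>
       functional u h = Some g" by blast
    show ?thesis
      unfolding medvedev_le_def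
    proof (intro exI[of _ u] ballI)
      fix h assume "h \<in> mp_join X Y"
      then obtain k l where h: "h = t (2 * k) \<oplus> t (Suc (2 * l))"
        unfolding mp_join_def X_def Y_def by auto
      define a b where "a = 2 * k" and "b = Suc (2 * l)"
      then have "a \<noteq> b" by presburger
      obtain c f where c: "\<forall>j<a. seq c j = q j" "t a = case_nat (pair a c) f" using t by blast
      obtain c' f' where c': "\<forall>j<b. seq c' j = q j" "t b = case_nat (pair b c') f'" using t by blast
      have h: "h (2 * x) = t a x" "h (Suc (2 * x)) = t b x" for x
        unfolding h a_def b_def by simp_all
      have h01: "h 0 = pair a c" "h 1 = pair b c'" using h[of 0] c c' by simp_all
      have "(\<lambda>x. if pi1 (h 0) < pi1 (h 1) then h (2 * x) else h (Suc (2 * x))) =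
          (if a < b then t a else t b)"
        unfolding h01 h prod_encode_inverse fst_conv by auto
      moreover have "(if pi1 (h 0) < pi1 (h 1) then seq (pi2 (h 1)) (pi1 (h 0))
          else seq (pi2 (h 0)) (pi1 (h 1))) = (if a < b then q a else q b)"
        unfolding h01 prod_encode_inverse fst_conv snd_conv using c(1) c'(1) \<open>a \<noteq> b\<close> by auto
      ultimately have u': "functional u h = Some g"
        if "functional (prog_of (if a < b then q a else q b)) (if a < b then t a else t b) = Some g" for g
        using that u[of h g] by (simp only:)
      show "\<exists>g\<in>R. functional u h = Some g"
        using q[of a] q[of b] u' by (cases "a < b") auto
    qed
  qed
  then have "J \<le> mdegree_join (abs_mdegree X) (abs_mdegree Y)"
    by (simp add: mdegree_join_abs R)
  then show False using join_prime[OF J] not_le R by blast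
qed

section \<open>Program size\<close>

primrec psize :: "prog \<Rightarrow> nat" where
  "psize Zero = 1"
| "psize Succ = 1"
| "psize Left = 1"
| "psize Right = 1"
| "psize Oracle = 1"
| "psize (Pair p q) = Suc (psize p + psize q)"
| "psize (Comp p q) = Suc (psize p + psize q)"
| "psize (Prec p q) = Suc (psize p + psize q)"
| "psize (Mn p) = Suc (psize p)"

lemma psize_pos: "1 \<le> psize p"
  by (cases p) simp_all

lemma finite_psize_le: "finite {p. psize p \<le> n}"
proof (induction n)
  case 0
  have "{p. psize p \<le> 0} = {}" using le_trans[OF psize_pos] by fastforce
  then show ?case by (simp only: finite.emptyI)
next
  case (Suc n)
  let ?S = "{p. psize p \<le> n}"
  let ?U = "{Zero, Succ, Left, Right, Oracle} \<union> case_prod Pair ` (?S \<times> ?S) \<union>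
    case_prod Comp ` (?S \<times> ?S) \<union> case_prod Prec ` (?S \<times> ?S) \<union> Mn ` ?S"
  have "{p. psize p \<le> Suc n} \<subseteq> ?U"
  proof
    fix p assume "p \<in> {p. psize p \<le> Suc n}"
    then show "p \<in> ?U" by (cases p) auto
  qed
  moreover have "finite ?U" using Suc by simp
  ultimately show ?case by (rule finite_subset)
qed

text \<open>Composing reductions at most multiplies sizes. Size is counted instead of the index
  under \<open>prog_of\<close> because it obeys this simple law and still admits only finitely many
  programs below each bound.\<close>

lemma psize_oracle_subst: "psize (oracle_subst r p) \<le> psize r * psize p"
proof (induction p)
  case (Mn p)
  then show ?case using psize_pos[of r] by simp
qed (use psize_pos[of r] in \<open>simp_all add: algebra_simps\<close>)

section \<open>Finite modifications and finite extensions\<close>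

definition overwrite :: "nat \<Rightarrow> nat \<Rightarrow> (nat \<Rightarrow> nat) \<Rightarrow> nat \<Rightarrow> nat" where
  "overwrite c s f k = (if k < s then seq c k else f k)"

lemma overwrite_inverse: "\<exists>c'. overwrite c' s (overwrite c s f) = f"
proof -
  obtain c' where "\<forall>k<s. seq c' k = f k" using ex_seq by meson
  then show ?thesis by (intro exI[of _ c']) (auto simp: overwrite_def fun_eq_iff)
qed

lemma effective_overwrite: "effective (\<lambda>f x. overwrite c s f x)"
  unfolding overwrite_def by (intro effective_intros effective_seq)

lemma computable_overwrite_iff: "computable (overwrite c s f) \<longleftrightarrow> computable f"
  using computable_of_effective[OF _ effective_overwrite] overwrite_inverse by metis

text \<open>A finite-extension argument. If some prefix extending the given one lets
  \<open>p\<close> halt with a value different from that of \<open>h\<close>, that prefix forces the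
  disagreement by the use principle. Otherwise every halting computation over such prefixes agrees
  with \<open>h\<close>, and if \<open>p\<close> produced \<open>h\<close> from some extension,
  searching through prefixes would compute \<open>h\<close>.\<close>

lemma avoid_one:
  assumes h: "\<not> computable h"
  shows "\<exists>c' s'. s \<le> s' \<and> (\<forall>k<s. seq c' k = seq c k) \<and>
    (\<forall>g. (\<forall>k<s'. g k = seq c' k) \<longrightarrow> functional p g \<noteq> Some h)"
proof -
  obtain e where e: "prog_of e = p" using surj_prog_of by (metis surjD)
  define Q where "Q x c' t y \<longleftrightarrow> certifies (seq c') t e x y \<and> (\<forall>k<s. seq c' k = seq c k)"
    for x c' t y
  show ?thesis
  proof (cases "\<exists>x c' t y. Q x c' t y \<and> y \<noteq> h x")
    case True
    then obtain x c' t y where *: "certifies (seq c') t e x y" "\<forall>k<s. seq c' k = seq c k" "y \<noteq> h x"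
      unfolding Q_def by blast
    have "functional p g \<noteq> Some h" if "\<forall>k<max s (use_bound t). g k = seq c' k" for g
    proof
      assume "functional p g = Some h"
      then have "exec g p x = Some (h x)" by (rule functional_exec)
      moreover have "certifies g t e x y"
        using that *(1) certifies_cong[of t g "seq c'"] by simp
      ultimately show False using certifies_sound e *(3) by fastforce
    qed
    with *(2) have "s \<le> max s (use_bound t) \<and> (\<forall>k<s. seq c' k = seq c k) \<and>
      (\<forall>g. (\<forall>k<max s (use_bound t). g k = seq c' k) \<longrightarrow> functional p g \<noteq> Some h)"
      by simp
    then show ?thesis by (intro exI)
  next
    case False
    have "decidable (\<lambda>f w. Q (pi1 w) (pi1 (pi2 w)) (pi1 (pi2 (pi2 w))) (pi2 (pi2 (pi2 w))))"
      unfolding Q_def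
      by (intro effective_intros effective_seq decidable_certifies[of "\<lambda>f v. seq v"])
    moreover have "effective (\<lambda>f w. pi2 (pi2 (pi2 w)))" by (intro effective_intros)
    ultimately obtain r where r: "\<And>f x. \<exists>n. Q x (pi1 n) (pi1 (pi2 n)) (pi2 (pi2 n)) \<Longrightarrow>
       \<exists>n. Q x (pi1 n) (pi1 (pi2 n)) (pi2 (pi2 n)) \<and> exec f r x = Some (pi2 (pi2 n))"
      using search[of "\<lambda>f x n. Q x (pi1 n) (pi1 (pi2 n)) (pi2 (pi2 n))" "\<lambda>f x n. pi2 (pi2 n)"]
      by blast
    have "functional p g \<noteq> Some h" if g: "\<forall>k<s. g k = seq c k" for g
    proof
      assume "functional p g = Some h"
      have "exec (\<lambda>_. 0) r x = Some (h x)" for x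
      proof -
        have "exec g p x = Some (h x)" using \<open>functional p g = Some h\<close> by (rule functional_exec)
        then obtain t where t: "certifies g t e x (h x)" using certifies_complete e by blast
        \<comment> \<open>A prefix of \<open>g\<close> that covers the positions below
          \<open>s\<close> and the use of \<open>t\<close> can stand in for
          \<open>g\<close>.\<close>
        obtain c' where c': "\<forall>k<max s (use_bound t). seq c' k = g k" using ex_seq by meson
        then have "Q x c' t (h x)" unfolding Q_def using t g certifies_cong[of t "seq c'" g] by simp
        then have "\<exists>n. Q x (pi1 n) (pi1 (pi2 n)) (pi2 (pi2 n))"
          by (metis fst_conv snd_conv prod_encode_inverse)
        from r[OF this] False show ?thesis by metis
      qed
      then have "computable h" unfolding computable_def by (blast intro: functionalI)
      with h show False by blast
    qed
    then have "s \<le> s \<and> (\<forall>k<s. seq c k = seq c k) \<and>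
      (\<forall>g. (\<forall>k<s. g k = seq c k) \<longrightarrow> functional p g \<noteq> Some h)"
      by (intro conjI allI impI order_refl refl)
    then show ?thesis by (intro exI)
  qed
qed

lemma avoid_finite:
  assumes "finite D" "\<And>p h. (p, h) \<in> D \<Longrightarrow> \<not> computable h"
  shows "\<exists>c s. \<forall>g. (\<forall>k<s. g k = seq c k) \<longrightarrow> (\<forall>(p, h)\<in>D. functional p g \<noteq> Some h)"
  using assms
proof (induction rule: finite_induct)
  case (insert d D)
  have "\<exists>c s. \<forall>g. (\<forall>k<s. g k = seq c k) \<longrightarrow> (\<forall>(p, h)\<in>D. functional p g \<noteq> Some h)"
    by (rule insert.IH) (rule insert.prems, rule insertI2)
  then obtain c s where
    "\<forall>g. (\<forall>k<s. g k = seq c k) \<longrightarrow> (\<forall>(p, h)\<in>D. functional p g \<noteq> Some h)"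
    by (elim exE)
  then have c: "\<forall>(p, h)\<in>D. functional p g \<noteq> Some h" if "\<forall>k<s. g k = seq c k" for g
    using that by simp
  obtain p h where d: "d = (p, h)" by fastforce
  then have "\<not> computable h" using insert.prems by blast
  from avoid_one[OF this, of s c p] obtain c' s' where c': "s \<le> s'" "\<forall>k<s. seq c' k = seq c k"
    "\<And>g. \<forall>k<s'. g k = seq c' k \<Longrightarrow> functional p g \<noteq> Some h" by blast
  show ?case
  proof (rule exI[of _ c'], rule exI[of _ s'], intro allI impI)
    fix g assume g: "\<forall>k<s'. g k = seq c' k"
    then have "\<forall>(p, h)\<in>D. functional p g \<noteq> Some h" using c' by (intro c) auto
    then show "\<forall>(p, h)\<in>insert d D. functional p g \<noteq> Some h" using c'(3)[OF g] d by auto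
  qed
qed simp

text \<open>Each stage has finitely many requirements: the programs of size at most the current
  index against the noncomputable functions obtained from each earlier \<open>F j\<close> by
  programs of size at most \<open>j\<close>. A prefix meeting all of them is written over
  \<open>f\<close>.\<close>

lemma independent_sequence:
  assumes f: "\<not> computable f"
  shows "\<exists>F. (\<forall>d. \<exists>c s. F d = overwrite c s f) \<and>
    (\<forall>d d' a b g. d \<noteq> d' \<longrightarrow> psize a \<le> d \<longrightarrow> psize b \<le> d' \<longrightarrow>
      functional a (F d) = Some g \<longrightarrow> functional b (F d') = Some g \<longrightarrow> computable g)"
proof -
  define P where "P L y \<longleftrightarrow> (\<exists>c s. y = overwrite c s f) \<and>
    (\<forall>j<length L. \<forall>a b g. psize a \<le> j \<longrightarrow> psize b \<le> length L \<longrightarrow> functional a (L ! j) = Some g \<longrightarrow>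
      functional b y = Some g \<longrightarrow> computable g)" for L y
  have "\<exists>y. P L y" for L
  proof -
    let ?G = "\<Union>j<length L. \<Union>a\<in>{a. psize a \<le> j}. {g. functional a (L ! j) = Some g \<and> \<not> computable g}"
    have "finite {g. functional a (L ! j) = Some g \<and> \<not> computable g}" for a j
      by (rule finite_subset[of _ "{the (functional a (L ! j))}"]) auto
    then have "finite ?G" by (intro finite_UN_I finite_lessThan finite_psize_le)
    then have "finite ({b. psize b \<le> length L} \<times> ?G)" using finite_psize_le by blast
    from avoid_finite[OF this] obtain c s where c:
      "\<And>g. \<forall>k<s. g k = seq c k \<Longrightarrow>
        \<forall>(p, h)\<in>{b. psize b \<le> length L} \<times> ?G. functional p g \<noteq> Some h" by auto
    have "\<forall>(p, h)\<in>{b. psize b \<le> length L} \<times> ?G. functional p (overwrite c s f) \<noteq> Some h"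
      by (rule c) (simp add: overwrite_def)
    then have "P L (overwrite c s f)" unfolding P_def by blast
    then show ?thesis by (rule exI[of _ "overwrite c s f"])
  qed
  then obtain F where F: "P (map F [0..<d]) (F d)" for d
    using course_of_values_choice[of P] by blast
  have less: "computable g" if "d < d'" "psize a \<le> d" "psize b \<le> d'"
    "functional a (F d) = Some g" "functional b (F d') = Some g" for d d' a b g
    using F[of d'] that unfolding P_def by auto
  show ?thesis
  proof (intro exI[of _ F] conjI allI impI)
    show "\<exists>c s. F d = overwrite c s f" for d using F unfolding P_def by blast
    show "computable g" if "d \<noteq> d'" "psize a \<le> d" "psize b \<le> d'"
    "functional a (F d) = Some g" "functional b (F d') = Some g" for d d' a b g
      using that less by (meson linorder_neqE_nat)
  qed
qed

section \<open>A lattice of problems below a noncomputable function\<close>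

lemma effective_cons: "effective (case_nat k)"
  by (rule effective_case_nat[of "\<lambda>h x. k" "\<lambda>h x. x" "\<lambda>h x. h"]) (intro effective_intros)+

text \<open>A numeral \<open>v\<close> costs \<open>v\<close> applications of \<open>Succ\<close>,
  hence size linear in \<open>v\<close>. The constant \<open>c\<close> is uniform in
  \<open>v\<close>, so that a functional can compute the size bound from \<open>v\<close> and
  announce it.\<close>

lemma parametrized_programs:
  assumes "effective (\<lambda>h w. G h (pi1 w) (pi2 w))"
  shows "\<exists>c. \<forall>v. \<exists>p. psize p \<le> c + 2 * v \<and> (\<forall>h. functional p h = Some (G h v))"
proof -
  obtain r where r: "exec h r w = Some (G h (pi1 w) (pi2 w))" for h w
    using assms unfolding effective_def by blast
  have const: "\<exists>p. psize p = 1 + 2 * v \<and> (\<forall>h x. exec h p x = Some v)" for v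
  proof (induction v)
    case 0
    show ?case by (intro exI[of _ Zero]) simp
  next
    case (Suc v)
    then obtain p where "psize p = 1 + 2 * v" "\<forall>h x. exec h p x = Some v" by blast
    then show ?case by (intro exI[of _ "Comp Succ p"]) simp
  qed
  show ?thesis
  proof (intro exI[of _ "psize r + 6"] allI)
    fix v
    obtain p where p: "psize p = 1 + 2 * v" "\<And>h x. exec h p x = Some v" using const by blast
    have "functional (Comp r (Pair p (Pair Left Right))) h = Some (G h v)" for h
      by (rule functionalI) (simp add: r p)
    then show "\<exists>p. psize p \<le> psize r + 6 + 2 * v \<and> (\<forall>h. functional p h = Some (G h v))"
      using p(1) by (intro exI[of _ "Comp r (Pair p (Pair Left Right))"]) simp
  qed
qed

lemma psize_join_prog: "psize (join_prog p q) = psize p + psize q + psize (join_prog Zero Zero) - 2"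
  by (simp add: join_prog_def)

text \<open>Only argument \<open>0\<close> needs a genuine search. At positive arguments the test is
  trivially true and the output does not depend on the witness, so searches at different arguments
  need not agree.\<close>

lemma search_head:
  assumes Q: "decidable Q" and A: "effective A"
  shows "\<exists>p. \<forall>z. (\<exists>w. Q z w) \<longrightarrow> (\<exists>w. Q z w \<and> functional p z = Some (case_nat (A z w) z))"
proof -
  have "decidable (\<lambda>z v. 0 < pi1 v \<or> Q z (pi2 v))"
    "effective (\<lambda>z v. case_nat (A z (pi2 v)) z (pi1 v))"
    by (intro effective_intros decidable_compose[OF Q] effective_compose[OF A])+
  from search[of "\<lambda>z x w. 0 < x \<or> Q z w" "\<lambda>z x w. case_nat (A z w) z x", OF this]
  obtain p where p: "\<And>z x. \<exists>w. 0 < x \<or> Q z w \<Longrightarrow>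
      \<exists>w. (0 < x \<or> Q z w) \<and> exec z p x = Some (case_nat (A z w) z x)" by blast
  show ?thesis
  proof (intro exI[of _ p] allI impI)
    fix z assume "\<exists>w. Q z w"
    with p[of 0 z] obtain w where w: "Q z w" "exec z p 0 = Some (A z w)" by auto
    have "exec z p x = Some (case_nat (A z w) z x)" for x
      using w(2) p[of x z] by (cases x) auto
    with w(1) show "\<exists>w. Q z w \<and> functional p z = Some (case_nat (A z w) z)"
      by (blast intro: functionalI)
  qed
qed

section \<open>Upsets of the Boolean cube and codes of their members\<close>

definition upset :: "nat \<Rightarrow> nat set set \<Rightarrow> bool" where
  "upset n B \<longleftrightarrow> B \<subseteq> Pow {..<n} \<and> (\<forall>K\<in>B. \<forall>K'\<subseteq>{..<n}. K \<subseteq> K' \<longrightarrow> K' \<in> B)"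

lemma upsetD: "upset n B \<Longrightarrow> K \<in> B \<Longrightarrow> K \<subseteq> K' \<Longrightarrow> K' \<subseteq> {..<n} \<Longrightarrow> K' \<in> B"
  and upset_subset: "upset n B \<Longrightarrow> K \<in> B \<Longrightarrow> K \<subseteq> {..<n}"
  unfolding upset_def by blast+

lemma upset_Int: "upset n B \<Longrightarrow> upset n C \<Longrightarrow> upset n (B \<inter> C)"
  unfolding upset_def by (intro conjI ballI allI impI IntI le_infI1) (elim IntE conjE, blast)+

text \<open>The Heyting implication of the lattice of upsets of the cube. Larger upsets will
  correspond to smaller degrees, intersection to join and union to meet.\<close>

definition upset_imp :: "nat \<Rightarrow> nat set set \<Rightarrow> nat set set \<Rightarrow> nat set set" where
  "upset_imp n B C = {K. K \<subseteq> {..<n} \<and> (\<forall>K'\<subseteq>{..<n}. K \<subseteq> K' \<longrightarrow> K' \<in> B \<longrightarrow> K' \<in> C)}"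

lemma upset_upset_imp: "upset n (upset_imp n B C)"
  unfolding upset_def upset_imp_def by auto

lemma finite_codes: "finite {k. set_decode k \<subseteq> {..<n}}"
proof (rule finite_subset)
  show "{k. set_decode k \<subseteq> {..<n}} \<subseteq> set_encode ` Pow {..<n}"
    by (metis (mono_tags, lifting) Pow_iff imageI mem_Collect_eq set_decode_inverse subsetI)
qed simp

lemma ex_code: "K \<subseteq> {..<n} \<Longrightarrow> \<exists>k. set_decode k = K"
  by (metis finite_lessThan finite_subset set_encode_inverse)

lemma case_nat_oplus_cong:
  assumes "\<forall>k<s. u k = u' k" "k < s"
  shows "(case_nat a u \<oplus> z) k = (case_nat a u' \<oplus> z) k"
proof (cases "k div 2")
  case (Suc i)
  then have "i < s" using assms(2) by linarith
  then show ?thesis using assms(1) Suc by (simp add: oplus_def)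
qed (simp add: oplus_def)

section \<open>The problems attached to an independent sequence\<close>

locale independent =
  fixes f :: "nat \<Rightarrow> nat" and F :: "nat \<Rightarrow> nat \<Rightarrow> nat"
  assumes noncomputable: "\<not> computable f"
    and F_overwrite: "\<exists>c s. F d = overwrite c s f"
    and F_independent: "d \<noteq> d' \<Longrightarrow> psize a \<le> d \<Longrightarrow> psize b \<le> d' \<Longrightarrow>
      functional a (F d) = Some g \<Longrightarrow> functional b (F d') = Some g \<Longrightarrow> computable g"
begin

text \<open>These are the functions to be avoided at index \<open>i\<close>. Raising
  \<open>m\<close> shrinks the set, and the multiplicative form of the cutoff matches the
  multiplicative growth of sizes under composition.\<close>

definition region :: "nat \<Rightarrow> nat \<Rightarrow> mass_problem" where
  "region i m = {g. \<exists>a e. psize a * Suc m \<le> e \<and> functional a (F (pair i e)) = Some g}"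

text \<open>The meet over \<open>K\<close> in \<open>B\<close> of the join of the basic problems
  with index in \<open>K\<close>. The code \<open>k\<close> names the chosen \<open>K\<close>, and a
  single function \<open>z\<close> with a single bound \<open>m\<close> serves all \<open>i\<close>
  in \<open>K\<close>.\<close>

definition problem :: "nat set set \<Rightarrow> mass_problem" where
  "problem B = {case_nat (pair k m) z | k m z.
     set_decode k \<in> B \<and> (\<forall>i\<in>set_decode k. z \<notin> region i m)}"

lemma noncomputable_F: "\<not> computable (F d)"
  using F_overwrite[of d] noncomputable computable_overwrite_iff by metis

text \<open>Since \<open>e \<le> pair i e\<close>, sizes bounded by \<open>e\<close> are small
  enough for the independence of the sequence.\<close>

lemma region_unique:
  assumes "\<not> computable g" "functional a (F (pair i e)) = Some g" "psize a \<le> e"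
    "functional b (F (pair j e')) = Some g" "psize b \<le> e'"
  shows "i = j \<and> e = e'"
  using assms F_independent[of "pair i e" "pair j e'" a b g]
    le_prod_encode_2[of e i] le_prod_encode_2[of e' j] by (auto dest: le_trans)

lemma region_antimono: "m \<le> m' \<Longrightarrow> region i m' \<subseteq> region i m"
proof -
  assume "m \<le> m'"
  then have "psize a * Suc m \<le> psize a * Suc m'" for a by (intro mult_le_mono2) simp
  then show ?thesis unfolding region_def by (blast intro: le_trans)
qed

lemma psize_le_mult: "psize a \<le> psize a * Suc m"
  by simp

lemma computable_in_region:
  assumes "computable g" shows "g \<in> region i m"
proof -
  obtain p where p: "functional p (\<lambda>_. 0) = Some g" using assms unfolding computable_def by blast
  have "functional Zero h = Some (\<lambda>_. 0)" for h by (rule functionalI) simp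
  then have "functional (oracle_subst Zero p) h = Some g" for h
    using p functional_oracle_subst by simp
  then show ?thesis unfolding region_def by blast
qed

text \<open>Being in \<open>region i 0\<close> yields some index \<open>e\<close>, and being in
  \<open>region i e\<close> yields an index that is at least \<open>e + 1\<close>; by uniqueness
  both indices would coincide.\<close>

lemma eventually_not_in_region: "\<exists>m. f \<notin> region i m"
proof (rule ccontr)
  assume "\<not> (\<exists>m. f \<notin> region i m)"
  then have all: "f \<in> region i m" for m by simp
  obtain a e where a: "psize a * Suc 0 \<le> e" "functional a (F (pair i e)) = Some f"
    using all[of 0] unfolding region_def by blast
  obtain b e' where b: "psize b * Suc e \<le> e'" "functional b (F (pair i e')) = Some f"
    using all[of e] unfolding region_def by blast
  have "psize b \<le> e'" using b(1) psize_le_mult le_trans by blast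
  then have "e = e'" using region_unique[OF noncomputable a(2) _ b(2)] a(1) by simp
  moreover have "1 * Suc e \<le> psize b * Suc e" using psize_pos by (intro mult_le_mono1)
  ultimately show False using b(1) by simp
qed

lemma eventually_not_in_regions:
  assumes "finite I" shows "\<exists>m. \<forall>i\<in>I. f \<notin> region i m"
  using assms
proof (induction rule: finite_induct)
  case (insert i I)
  then obtain m where m: "\<forall>i\<in>I. f \<notin> region i m" by blast
  obtain m' where m': "f \<notin> region i m'" using eventually_not_in_region by blast
  have "f \<notin> region j (max m m')" if "j \<in> insert i I" for j
    using that m m' subsetD[OF region_antimono[OF max.cobounded1[of m m']], of f j]
      subsetD[OF region_antimono[OF max.cobounded2[of m' m]], of f j] by blast
  then have "\<forall>i\<in>insert i I. f \<notin> region i (max m m')" by blast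
  then show ?case ..
qed simp

text \<open>The factor that \<open>q\<close> contributes to the program size is absorbed by passing
  from \<open>m\<close> to the larger bound \<open>M\<close>.\<close>

lemma region_reduce:
  assumes q: "functional q h = Some g" and h: "h \<in> region i M" and M: "psize q * Suc m \<le> Suc M"
  shows "g \<in> region i m"
proof -
  obtain a e where a: "psize a * Suc M \<le> e" "functional a (F (pair i e)) = Some h"
    using h unfolding region_def by blast
  have "psize (oracle_subst a q) * Suc m \<le> psize a * psize q * Suc m"
    using psize_oracle_subst by (intro mult_le_mono1)
  also have "\<dots> \<le> psize a * Suc M" using M by (simp only: mult.assoc mult_le_mono2)
  finally have "psize (oracle_subst a q) * Suc m \<le> e" using a(1) by simp
  moreover have "functional (oracle_subst a q) (F (pair i e)) = Some g"
    using functional_oracle_subst[OF a(2)] q by simp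
  ultimately show ?thesis unfolding region_def by blast
qed

section \<open>Joins, meets and implications of the problems\<close>

lemma problem_mono: "B \<subseteq> C \<Longrightarrow> problem B \<subseteq> problem C"
  unfolding problem_def by blast

lemma problemI:
  "set_decode k \<in> B \<Longrightarrow> \<forall>i\<in>set_decode k. z \<notin> region i m \<Longrightarrow> case_nat (pair k m) z \<in> problem B"
  unfolding problem_def by blast

lemma problemE:
  assumes "x \<in> problem B"
  obtains k m z where "x = case_nat (pair k m) z" "set_decode k \<in> B"
    "\<forall>i\<in>set_decode k. z \<notin> region i m"
  using assms unfolding problem_def by blast

text \<open>The two solutions are merged into \<open>z \<oplus> z'\<close> with the union of the two
  coded sets, which lies in both upsets. A small program for the merged function would give small
  programs for both halves.\<close>

lemma problem_Int_le:
  assumes B: "upset n B" and C: "upset n C"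
  shows "problem (B \<inter> C) \<le>\<^sub>M mp_join (problem B) (problem C)"
proof -
  let ?E = "{k. set_decode k \<subseteq> {..<n}}"
  obtain T where T: "\<And>k k'. k \<in> ?E \<Longrightarrow> k' \<in> ?E \<Longrightarrow>
      T (pair k k') = set_encode (set_decode k \<union> set_decode k')"
    and eT: "effective (\<lambda>h x. T (pair (pi1 (h 0)) (pi1 (h 1))))"
  proof -
    have "finite (prod_encode ` (?E \<times> ?E))" using finite_codes by blast
    moreover have "effective (\<lambda>h x. pair (pi1 (h 0)) (pi1 (h 1)))" by (intro effective_intros)
    ultimately obtain T where "\<forall>v\<in>prod_encode ` (?E \<times> ?E).
        T v = set_encode (set_decode (pi1 v) \<union> set_decode (pi2 v))"
      "effective (\<lambda>h x. T (pair (pi1 (h 0)) (pi1 (h 1))))"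
      using effective_table[of "prod_encode ` (?E \<times> ?E)" "\<lambda>h x. pair (pi1 (h 0)) (pi1 (h 1))"
          "\<lambda>v. set_encode (set_decode (pi1 v) \<union> set_decode (pi2 v))"] by auto
    then show ?thesis by (intro that[of T]) auto
  qed
  obtain q1 q2 where q: "\<And>h. functional q1 h = Some (\<lambda>x. h (2 * x))"
    "\<And>h. functional q2 h = Some (\<lambda>x. h (Suc (2 * x)))"
  proof -
    have "effective (\<lambda>h x. h (2 * x))" "effective (\<lambda>h x. h (Suc (2 * x)))"
      by (intro effective_intros)+
    then show ?thesis using functional_of_effective that by metis
  qed
  \<comment> \<open>The bound built from \<open>c\<close> exceeds what \<open>region_reduce\<close>
    asks for when the merged function is projected by \<open>q1\<close> or by
    \<open>q2\<close>.\<close>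
  define c where "c = psize q1 + psize q2"
  define H where "H h = case_nat (pair (T (pair (pi1 (h 0)) (pi1 (h 1))))
      (c * (Suc (pi2 (h 0)) + Suc (pi2 (h 1)))))
      ((\<lambda>x. h (2 * Suc x)) \<oplus> (\<lambda>x. h (Suc (2 * Suc x))))" for h
  show ?thesis
  proof (rule medvedev_leI[of H])
    show "effective H"
      unfolding H_def
      by (intro effective_case_nat[of _ "\<lambda>h x. x", OF _ effective_id] effective_intros eT)
    fix h assume "h \<in> mp_join (problem B) (problem C)"
    then obtain x x' where h: "h = x \<oplus> x'" "x \<in> problem B" "x' \<in> problem C"
      unfolding mp_join_def by blast
    obtain k m z where x: "x = case_nat (pair k m) z" "set_decode k \<in> B"
      "\<forall>i\<in>set_decode k. z \<notin> region i m" using h(2) by (rule problemE)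
    obtain k' m' z' where x': "x' = case_nat (pair k' m') z'" "set_decode k' \<in> C"
      "\<forall>i\<in>set_decode k'. z' \<notin> region i m'" using h(3) by (rule problemE)
    have h0: "h 0 = pair k m" "h 1 = pair k' m'" unfolding h x x' by (simp_all add: oplus_def)
    have hS: "(\<lambda>i. h (2 * Suc i)) = z" "(\<lambda>i. h (Suc (2 * Suc i))) = z'"
      unfolding h(1) oplus_even oplus_odd x(1) x'(1) by simp_all
    define M where "M = c * (Suc m + Suc m')"
    have K: "set_decode k \<subseteq> {..<n}" "set_decode k' \<subseteq> {..<n}"
      using upset_subset B C x(2) x'(2) by blast+
    have T': "T (pair k k') = set_encode (set_decode k \<union> set_decode k')" using T K by blast
    then have dec: "set_decode (T (pair k k')) = set_decode k \<union> set_decode k'"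
      by (simp add: finite_set_decode set_encode_inverse)
    have H: "H h = case_nat (pair (T (pair k k')) M) (z \<oplus> z')"
      unfolding H_def hS h0 M_def by simp
    have "z \<oplus> z' \<notin> region i M" if "i \<in> set_decode k \<union> set_decode k'" for i
    proof
      assume *: "z \<oplus> z' \<in> region i M"
      have "psize q1 * Suc m \<le> M" "psize q2 * Suc m' \<le> M"
        unfolding M_def c_def by (intro mult_le_mono; simp)+
      then have "z \<in> region i m" "z' \<in> region i m'"
        using region_reduce[OF q(1) *, of m] region_reduce[OF q(2) *, of m'] by simp_all
      with that x(3) x'(3) show False by blast
    qed
    moreover have "set_decode k \<union> set_decode k' \<in> B \<inter> C"
      using upsetD[OF B x(2)] upsetD[OF C x'(2)] K by auto
    ultimately show "H h \<in> problem (B \<inter> C)" unfolding H by (intro problemI) (simp_all add: dec)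
  qed
qed

text \<open>The coded set stands in the first entry, and a finite table tells whether it belongs to
  \<open>B\<close>.\<close>

lemma problem_Un_ge:
  assumes B: "upset n B" and C: "upset n C"
  shows "mp_meet (problem B) (problem C) \<le>\<^sub>M problem (B \<union> C)"
proof -
  let ?E = "{k. set_decode k \<subseteq> {..<n}}"
  have "effective (\<lambda>h x. pi1 (h 0))" by (intro effective_intros)
  from effective_table[OF finite_codes[of n] this, of "\<lambda>k. of_bool (set_decode k \<notin> B)"]
  obtain T where T: "\<forall>k\<in>?E. T k = of_bool (set_decode k \<notin> B)" "effective (\<lambda>h x. T (pi1 (h 0)))"
    by blast
  show ?thesis
  proof (rule medvedev_leI[of "\<lambda>h. case_nat (T (pi1 (h 0))) h"])
    show "effective (\<lambda>h. case_nat (T (pi1 (h 0))) h)"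
      by (intro effective_case_nat[of _ "\<lambda>h x. x", OF _ effective_id] effective_intros T)
    fix h assume h: "h \<in> problem (B \<union> C)"
    then obtain k m z where k: "h = case_nat (pair k m) z" "set_decode k \<in> B \<union> C"
      "\<forall>i\<in>set_decode k. z \<notin> region i m" by (rule problemE)
    have "set_decode k \<subseteq> {..<n}" using k(2) upset_subset B C by blast
    then have "T (pi1 (h 0)) = of_bool (set_decode k \<notin> B)" using T(1) k(1) by simp
    moreover have "set_decode k \<in> B \<Longrightarrow> h \<in> problem B" "set_decode k \<in> C \<Longrightarrow> h \<in> problem C"
      using k problemI by blast+
    ultimately show "case_nat (T (pi1 (h 0))) h \<in> mp_meet (problem B) (problem C)"
      using k(2) unfolding mp_meet_def by auto
  qed
qed

text \<open>For the principal upset at \<open>K0\<close>, the solution \<open>z\<close> itself is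
  kept and only a head is computed for it. If \<open>z\<close> came from \<open>F (pair i d)\<close>
  by a small program with \<open>i\<close> outside \<open>K0\<close>, then a version of
  \<open>F (pair i d)\<close> would be a legitimate left input, and \<open>F (pair i d)\<close>
  would compute the output of the reduction by a program too small for the bound that this output
  announces.\<close>

lemma problem_principal_imp:
  assumes C: "upset n C" and K0: "K0 \<subseteq> {..<n}"
    and le: "problem C \<le>\<^sub>M mp_join (problem {K. K0 \<subseteq> K \<and> K \<subseteq> {..<n}}) Z"
  shows "problem {K. K \<subseteq> {..<n} \<and> K \<union> K0 \<in> C} \<le>\<^sub>M Z"
proof -
  let ?U = "{K. K0 \<subseteq> K \<and> K \<subseteq> {..<n}}" and ?E = "{k. set_decode k \<subseteq> {..<n}}"
  obtain p where p: "\<And>x z. x \<in> problem ?U \<Longrightarrow> z \<in> Z \<Longrightarrow>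
      \<exists>g\<in>problem C. functional p (x \<oplus> z) = Some g"
    using le unfolding medvedev_le_def mp_join_def by blast
  obtain e where e: "prog_of e = p" using surj_prog_of by (metis surjD)
  obtain k0 where k0: "set_decode k0 = K0" using ex_code[OF K0] by blast
  \<comment> \<open>The witness \<open>w\<close> is \<open>pair (pair m c) (pair t y)\<close>: an
    input with head \<open>pair k0 m\<close> followed by a prefix of \<open>seq c\<close>, and a
    certificate \<open>t\<close> that the reduction then outputs \<open>y\<close> at argument
    \<open>0\<close>.\<close>
  define Q where "Q z w \<longleftrightarrow>
      certifies (case_nat (pair k0 (pi1 (pi1 w))) (seq (pi2 (pi1 w))) \<oplus> z) (pi1 (pi2 w)) e 0 (pi2 (pi2 w))"
    for z w
  have "effective (\<lambda>h w. overwrite (pi1 (pi1 w)) (pi2 (pi1 w)) h (pi2 w))"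
    unfolding overwrite_def by (intro effective_intros effective_seq)
  from parametrized_programs[of "\<lambda>h v. overwrite (pi1 v) (pi2 v) h", OF this]
  obtain c1 where c1: "\<And>v. \<exists>r. psize r \<le> c1 + 2 * v \<and>
      (\<forall>h. functional r h = Some (overwrite (pi1 v) (pi2 v) h))" by blast
  have "effective (\<lambda>h w. (case_nat (pair k0 (pi1 (pi1 w)))
      (overwrite (pi1 (pi2 (pi1 w))) (pi2 (pi2 (pi1 w))) (\<lambda>x. h (2 * x))) \<oplus> (\<lambda>x. h (Suc (2 * x)))) (pi2 w))"
    unfolding overwrite_def by (intro effective_intros effective_seq)
  from parametrized_programs[of "\<lambda>h v. case_nat (pair k0 (pi1 v))
      (overwrite (pi1 (pi2 v)) (pi2 (pi2 v)) (\<lambda>x. h (2 * x))) \<oplus> (\<lambda>x. h (Suc (2 * x)))", OF this]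
  obtain c2 where c2: "\<And>v. \<exists>r. psize r \<le> c2 + 2 * v \<and>
      (\<forall>h. functional r h = Some (case_nat (pair k0 (pi1 v))
        (overwrite (pi1 (pi2 v)) (pi2 (pi2 v)) (\<lambda>x. h (2 * x))) \<oplus> (\<lambda>x. h (Suc (2 * x)))))" by blast
  define c3 where "c3 = psize (join_prog Zero Zero)"
  have c3: "psize (join_prog Oracle a) \<le> (1 + c3) * psize a" for a
  proof -
    have "psize (join_prog Oracle a) \<le> psize a + c3 * 1"
      unfolding c3_def psize_join_prog[of Oracle a] by simp
    also have "\<dots> \<le> psize a + c3 * psize a"
      using psize_pos by (intro add_left_mono mult_le_mono2)
    finally show ?thesis by simp
  qed
  let ?cs = "\<lambda>w. pair (pi2 (pi1 w)) (use_bound (pi1 (pi2 w)))"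
  \<comment> \<open>The product bounds the size that is added on the way from \<open>z\<close> to
    the output of \<open>p\<close> without its head, scaled by the bound that this output announces.
    The last summand makes every index \<open>d\<close> in question large enough for the overwriting
    program to fall under independence.\<close>
  define bound where "bound w =
     (1 + c3) * ((c2 + 2 * pair (pi1 (pi1 w)) (?cs w)) * (psize p + 2)) * Suc (pi2 (pi2 (pi2 w))) +
     (c1 + 2 * ?cs w)" for w
  have "effective (\<lambda>z w. pi1 (pi2 (pi2 w)))" by (intro effective_intros)
  from effective_table[OF finite_codes[of n] this, of "\<lambda>k. set_encode (set_decode k - K0)"]
  obtain T where T: "\<forall>k\<in>?E. T k = set_encode (set_decode k - K0)"
    and eT: "effective (\<lambda>(z :: nat \<Rightarrow> nat) w. T (pi1 (pi2 (pi2 w))))" by blast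
  have decQ: "decidable Q"
    unfolding Q_def
    by (intro decidable_certifies[of "\<lambda>z v. case_nat (pair k0 (pi1 v)) (seq (pi2 v)) \<oplus> z"]
        effective_intros effective_seq)
  have "effective (\<lambda>z w. pair (T (pi1 (pi2 (pi2 w)))) (bound w))"
    unfolding bound_def by (intro effective_intros eT)
  from search_head[OF decQ this] obtain q where q: "\<forall>z. (\<exists>w. Q z w) \<longrightarrow> (\<exists>w. Q z w \<and>
      functional q z = Some (case_nat (pair (T (pi1 (pi2 (pi2 w)))) (bound w)) z))"
    by (rule exE)
  have "\<exists>g\<in>problem {K. K \<subseteq> {..<n} \<and> K \<union> K0 \<in> C}. functional q z = Some g" if z: "z \<in> Z" for z
  proof -
    have "\<exists>w. Q z w"
    proof -
      \<comment> \<open>With \<open>m\<close> large, \<open>f\<close> is a left input, so the search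
        has a witness.\<close>
      obtain m where m: "\<forall>i\<in>K0. f \<notin> region i m"
        using eventually_not_in_regions[OF finite_subset[OF K0 finite_lessThan]] by (rule exE)
      then have "case_nat (pair k0 m) f \<in> problem ?U" using k0 K0 by (intro problemI) auto
      from p[OF this z] obtain g where "functional p (case_nat (pair k0 m) f \<oplus> z) = Some g" by blast
      then have "exec (case_nat (pair k0 m) f \<oplus> z) (prog_of e) 0 = Some (g 0)"
        unfolding e by (rule functional_exec)
      from certifies_complete[OF this] obtain t
        where t: "certifies (case_nat (pair k0 m) f \<oplus> z) t e 0 (g 0)" by blast
      obtain c where c: "\<forall>k<use_bound t. seq c k = f k"
        using ex_seq[of "use_bound t" f] by blast
      have "certifies (case_nat (pair k0 m) (seq c) \<oplus> z) t e 0 (g 0)"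
        using t certifies_cong[of t "case_nat (pair k0 m) (seq c) \<oplus> z"] case_nat_oplus_cong[OF c]
        by blast
      then have "Q z (pair (pair m c) (pair t (g 0)))" unfolding Q_def by simp
      then show ?thesis ..
    qed
    from q[THEN spec, THEN mp, OF this] obtain w where w: "Q z w"
      and qz: "functional q z = Some (case_nat (pair (T (pi1 (pi2 (pi2 w)))) (bound w)) z)" by blast
    define m c t y where "m = pi1 (pi1 w)" and "c = pi2 (pi1 w)" and "t = pi1 (pi2 w)" and "y = pi2 (pi2 w)"
    define s where "s = use_bound t"
    define x where "x i d = case_nat (pair k0 m) (overwrite c s (F (pair i d)))" for i d
    have bound: "bound w =
      (1 + c3) * ((c2 + 2 * pair m (pair c s)) * (psize p + 2)) * Suc (pi2 y) + (c1 + 2 * pair c s)"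
      unfolding bound_def m_def c_def s_def t_def y_def by simp
    \<comment> \<open>The prefix found by the search is continued along \<open>F (pair i d)\<close>.
      Independence keeps the result out of the regions with index in \<open>K0\<close>, and the use
      principle preserves the first output value \<open>y\<close>.\<close>
    have key: "\<exists>g\<in>problem C. functional p (x i d \<oplus> z) = Some g \<and> g 0 = y"
      if i: "i \<notin> K0" and d: "c1 + 2 * pair c s \<le> d" for i d
    proof -
      obtain r where r: "psize r \<le> c1 + 2 * pair c s" "\<And>h. functional r h = Some (overwrite c s h)"
        using c1[of "pair c s"] by auto
      have "overwrite c s (F (pair i d)) \<notin> region j m" if "j \<in> K0" for j
      proof
        assume "overwrite c s (F (pair i d)) \<in> region j m"
        then obtain b d' where b: "psize b * Suc m \<le> d'"
          "functional b (F (pair j d')) = Some (overwrite c s (F (pair i d)))"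
          unfolding region_def by blast
        have "psize b \<le> d'" using b(1) psize_le_mult le_trans by blast
        moreover have "psize r \<le> d" using r(1) d by simp
        moreover have "\<not> computable (overwrite c s (F (pair i d)))"
          using noncomputable_F by (simp add: computable_overwrite_iff)
        ultimately have "i = j" using region_unique[OF _ r(2) _ b(2)] by blast
        with i \<open>j \<in> K0\<close> show False by blast
      qed
      then have "x i d \<in> problem ?U" unfolding x_def using k0 K0 by (intro problemI) auto
      from p[OF this z] obtain g where g: "g \<in> problem C" "functional p (x i d \<oplus> z) = Some g" by blast
      have agree: "\<forall>k<s. overwrite c s (F (pair i d)) k = seq c k" by (simp add: overwrite_def)
      have "\<forall>k<use_bound t. (x i d \<oplus> z) k = (case_nat (pair k0 m) (seq c) \<oplus> z) k"
        using case_nat_oplus_cong[OF agree] unfolding x_def s_def by blast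
      from certifies_cong[OF this] w have "certifies (x i d \<oplus> z) t e 0 y"
        unfolding Q_def m_def c_def t_def y_def by simp
      then have "exec (x i d \<oplus> z) p 0 = Some y" using certifies_sound e by blast
      then have "g 0 = y" using functional_exec[OF g(2), of 0] by simp
      with g show ?thesis by blast
    qed
    define k m' where "k = pi1 y" and "m' = pi2 y"
    have y: "y = pair k m'" unfolding k_def m'_def by simp
    have kC: "set_decode k \<in> C"
    proof -
      \<comment> \<open>The number \<open>n\<close> merely supplies an index outside
        \<open>K0\<close>, hence a genuine run whose output starts with \<open>y\<close>; so the set
        announced by \<open>y\<close> belongs to \<open>C\<close>.\<close>
      have "n \<notin> K0" using K0 by auto
      from key[OF this order_refl] obtain g where "g \<in> problem C" "g 0 = y" by blast
      then show ?thesis by (elim problemE) (simp add: y)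
    qed
    then have kn: "set_decode k \<subseteq> {..<n}" using upset_subset[OF C] by blast
    then have dec: "set_decode (T k) = set_decode k - K0"
      using T by (simp add: finite_set_decode set_encode_inverse)
    have "z \<notin> region i (bound w)" if i: "i \<in> set_decode k - K0" for i
    proof
      assume "z \<in> region i (bound w)"
      then obtain a d where a: "psize a * Suc (bound w) \<le> d" "functional a (F (pair i d)) = Some z"
        unfolding region_def by blast
      let ?v = "pair m (pair c s)"
      obtain r where r: "psize r \<le> c2 + 2 * ?v" "\<And>h. functional r h = Some (case_nat (pair k0 m)
        (overwrite c s (\<lambda>x. h (2 * x))) \<oplus> (\<lambda>x. h (Suc (2 * x))))"
        using c2[of ?v] by auto
      have "1 * Suc (bound w) \<le> psize a * Suc (bound w)" using psize_pos by (intro mult_le_mono1)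
      from le_trans[OF this a(1)] have "bound w \<le> d" by simp
      then have "c1 + 2 * pair c s \<le> d" unfolding bound by simp
      from key[OF _ this, of i] i obtain g
        where g: "g \<in> problem C" "functional p (x i d \<oplus> z) = Some g" "g 0 = y" by blast
      then obtain h where h: "g = case_nat (pair k m') h" "\<forall>i\<in>set_decode k. h \<notin> region i m'"
        using y by (elim problemE) auto
      have "functional Oracle (F (pair i d)) = Some (F (pair i d))" by (rule functionalI) simp
      then have "functional (join_prog Oracle a) (F (pair i d)) = Some (F (pair i d) \<oplus> z)"
        using functional_join_prog a(2) by blast
      moreover have "functional r (F (pair i d) \<oplus> z) = Some (x i d \<oplus> z)"
        unfolding r(2) x_def by simp
      moreover have "functional (Comp p Succ) (x i d \<oplus> z) = Some h"
        using functional_exec[OF g(2)] h(1) by (intro functionalI) simp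
      \<comment> \<open>The composite passes from \<open>F (pair i d)\<close> to its join with
        \<open>z\<close>, then to \<open>x i d \<oplus> z\<close>, then to the output with its head
        removed by \<open>Succ\<close>.\<close>
      ultimately have *: "functional (oracle_subst (join_prog Oracle a) (oracle_subst r (Comp p Succ)))
          (F (pair i d)) = Some h" (is "functional ?b _ = _")
        by (simp only: functional_oracle_subst)
      have "psize ?b \<le> psize (join_prog Oracle a) * (psize r * psize (Comp p Succ))"
        by (meson le_trans mult_le_mono2 psize_oracle_subst)
      also have "\<dots> \<le> ((1 + c3) * psize a) * ((c2 + 2 * ?v) * (psize p + 2))"
        using c3 r(1) by (intro mult_le_mono) simp_all
      finally have "psize ?b * Suc m' \<le> ((1 + c3) * psize a) * ((c2 + 2 * ?v) * (psize p + 2)) * Suc m'"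
        by (rule mult_le_mono1)
      also have "\<dots> = psize a * ((1 + c3) * ((c2 + 2 * ?v) * (psize p + 2)) * Suc m')"
        by (simp only: mult_ac)
      also have "\<dots> \<le> psize a * Suc (bound w)"
        unfolding bound m'_def by (intro mult_le_mono2) simp
      finally have "psize ?b * Suc m' \<le> d" using a(1) by simp
      with * have "h \<in> region i m'" unfolding region_def by blast
      with h(2) i show False by blast
    qed
    moreover have "set_decode k \<union> K0 \<in> C" using upsetD[OF C kC] kn K0 by blast
    ultimately have "case_nat (pair (T k) (bound w)) z \<in> problem {K. K \<subseteq> {..<n} \<and> K \<union> K0 \<in> C}"
      using kn by (intro problemI) (auto simp: dec)
    then show ?thesis using qz unfolding k_def y_def by blast
  qed
  then show ?thesis unfolding medvedev_le_def by blast
qed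

lemma problem_UNIV: "{} \<in> B \<Longrightarrow> problem B \<le>\<^sub>M Z"
proof (rule medvedev_leI[of "case_nat (pair 0 0)"])
  show "effective (case_nat (pair 0 0))" by (rule effective_cons)
  show "{} \<in> B \<Longrightarrow> case_nat (pair 0 0) z \<in> problem B" for z
    by (rule problemI) simp_all
qed

lemma upset_translate:
  assumes C: "upset n C" shows "upset n {K. K \<subseteq> {..<n} \<and> K \<union> K0 \<in> C}"
  unfolding upset_def
proof (intro conjI ballI allI impI)
  fix K K' assume K: "K \<in> {K. K \<subseteq> {..<n} \<and> K \<union> K0 \<in> C}" "K' \<subseteq> {..<n}" "K \<subseteq> K'"
  then have "K \<union> K0 \<in> C" by simp
  moreover from upset_subset[OF C this] K(2,3) have "K \<union> K0 \<subseteq> K' \<union> K0" "K' \<union> K0 \<subseteq> {..<n}" by auto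
  ultimately have "K' \<union> K0 \<in> C" by (rule upsetD[OF C])
  with K(2) show "K' \<in> {K. K \<subseteq> {..<n} \<and> K \<union> K0 \<in> C}" by simp
qed auto

text \<open>An upset is the finite union of the principal upsets at its members, and implication
  turns this union into an intersection of principal implications, that is, into a finite join of
  degrees.\<close>

lemma problem_imp_le:
  assumes B: "upset n B" and C: "upset n C" and le: "problem C \<le>\<^sub>M mp_join (problem B) Z"
  shows "problem (upset_imp n B C) \<le>\<^sub>M Z"
proof -
  let ?D = "\<lambda>S. Pow {..<n} \<inter> (\<Inter>K0\<in>S. {K. K \<subseteq> {..<n} \<and> K \<union> K0 \<in> C})"
  have "upset n (?D S) \<and> problem (?D S) \<le>\<^sub>M Z" if "finite S" "S \<subseteq> B" for S
    using that
  proof (induction rule: finite_induct)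
    case empty
    have "upset n (Pow {..<n})" by (auto simp: upset_def)
    then show ?case using problem_UNIV by simp
  next
    case (insert K0 S)
    let ?K = "{K. K \<subseteq> {..<n} \<and> K \<union> K0 \<in> C}"
    have K0: "K0 \<in> B" "K0 \<subseteq> {..<n}" using insert.prems upset_subset[OF B] by auto
    have "{K. K0 \<subseteq> K \<and> K \<subseteq> {..<n}} \<subseteq> B" using upsetD[OF B K0(1)] by blast
    then have "problem B \<le>\<^sub>M problem {K. K0 \<subseteq> K \<and> K \<subseteq> {..<n}}"
      by (intro medvedev_le_subset problem_mono)
    then have "problem C \<le>\<^sub>M mp_join (problem {K. K0 \<subseteq> K \<and> K \<subseteq> {..<n}}) Z"
      using le medvedev_join_mono[OF _ medvedev_le_refl] medvedev_le_trans by blast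
    from problem_principal_imp[OF C K0(2) this] have 1: "problem ?K \<le>\<^sub>M Z" .
    have 2: "upset n (?D S)" "problem (?D S) \<le>\<^sub>M Z" using insert by auto
    have eq: "?D (insert K0 S) = ?K \<inter> ?D S" by (simp only: INT_insert Int_left_commute)
    have "upset n (?K \<inter> ?D S)" using upset_translate[OF C] 2(1) by (rule upset_Int)
    moreover have "problem (?K \<inter> ?D S) \<le>\<^sub>M Z"
      using problem_Int_le[OF upset_translate[OF C] 2(1)] medvedev_join_le[OF 1 2(2)]
      by (rule medvedev_le_trans)
    ultimately show ?case unfolding eq by blast
  qed
  moreover have "finite B" using B finite_subset[of B "Pow {..<n}"] unfolding upset_def by simp
  ultimately have "problem (?D B) \<le>\<^sub>M Z" by blast
  moreover have "?D B \<subseteq> upset_imp n B C"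
  proof
    fix K assume K: "K \<in> ?D B"
    have "K' \<in> C" if "K \<subseteq> K'" "K' \<in> B" for K'
    proof -
      have "K \<union> K' \<in> C" using K that(2) by blast
      moreover have "K \<union> K' = K'" using that(1) by blast
      ultimately show ?thesis by simp
    qed
    then show "K \<in> upset_imp n B C" using K unfolding upset_imp_def by blast
  qed
  ultimately show ?thesis by (meson medvedev_le_subset medvedev_le_trans problem_mono)
qed

lemma problem_le_join_imp:
  assumes B: "upset n B" and C: "upset n C"
  shows "problem C \<le>\<^sub>M mp_join (problem B) (problem (upset_imp n B C))"
proof -
  have "B \<inter> upset_imp n B C \<subseteq> C" unfolding upset_imp_def by auto
  then have "problem C \<le>\<^sub>M problem (B \<inter> upset_imp n B C)"
    by (intro medvedev_le_subset problem_mono)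
  then show ?thesis
    using problem_Int_le[OF B upset_upset_imp] medvedev_le_trans by blast
qed

section \<open>Position of the problems relative to \<open>J\<close> and to the least degree\<close>

lemma F_le: "{F d} \<le>\<^sub>M {f}"
proof -
  obtain c s where "F d = overwrite c s f" using F_overwrite by blast
  then show ?thesis using medvedev_leI[OF effective_overwrite[of c s], of "{f}" "{F d}"] by simp
qed

text \<open>Every \<open>F d\<close> is computable from \<open>f\<close>, so no element of
  \<open>J\<close> lies in any region; with a suitable head each of them is a solution.\<close>

lemma problem_le:
  assumes B: "upset n B" "K \<in> B" and J: "\<not> J \<le>\<^sub>M {f}"
  shows "problem B \<le>\<^sub>M J"
proof -
  obtain k where k: "set_decode k = K" using ex_code upset_subset[OF B] by blast
  show ?thesis
  proof (rule medvedev_leI[OF effective_cons[of "pair k 0"]])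
    fix h assume h: "h \<in> J"
    have "h \<notin> region i 0" for i
    proof
      assume "h \<in> region i 0"
      then obtain a d where "functional a (F d) = Some h" unfolding region_def by blast
      then have "J \<le>\<^sub>M {F d}" using h unfolding medvedev_le_def by blast
      with J F_le medvedev_le_trans show False by blast
    qed
    then show "case_nat (pair k 0) h \<in> problem B" using B(2) k by (intro problemI) auto
  qed
qed

text \<open>With a large bound in its head, \<open>f\<close> is a solution, but it computes no
  element of \<open>J\<close>.\<close>

lemma not_le_problem:
  assumes B: "upset n B" "K \<in> B" and J: "\<not> J \<le>\<^sub>M {f}"
  shows "\<not> J \<le>\<^sub>M problem B"
proof -
  obtain k where k: "set_decode k = K" using ex_code upset_subset[OF B] by blast
  obtain m where m: "\<forall>i\<in>K. f \<notin> region i m"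
    using eventually_not_in_regions[OF finite_subset[OF upset_subset[OF B] finite_lessThan]]
    by (rule exE)
  have "problem B \<le>\<^sub>M {f}"
    using B(2) k m by (intro medvedev_leI[OF effective_cons[of "pair k m"]]) (auto intro: problemI)
  with J medvedev_le_trans show ?thesis by blast
qed

text \<open>Computable functions lie in every region, so a computable solution can only name the
  empty set.\<close>

lemma problem_nonzero:
  assumes "{} \<notin> B" shows "\<not> problem B \<le>\<^sub>M UNIV"
proof
  assume "problem B \<le>\<^sub>M UNIV"
  then obtain p x where x: "functional p (\<lambda>_. 0) = Some x" "x \<in> problem B"
    unfolding medvedev_le_def by blast
  obtain k m z where k: "x = case_nat (pair k m) z" "set_decode k \<in> B"
    "\<forall>i\<in>set_decode k. z \<notin> region i m" using x(2) by (rule problemE)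
  have "effective (\<lambda>h x. h (Suc x))" by (intro effective_intros)
  then have "computable (\<lambda>i. x (Suc i))"
    using computable_of_effective[of x "\<lambda>h i. h (Suc i)"] x(1) computable_def by blast
  then have "computable z" unfolding k(1) by simp
  then have "set_decode k = {}" using k(3) computable_in_region by blast
  with k(2) assms show False by simp
qed

end

lemma ex_independent: "\<not> computable f \<Longrightarrow> \<exists>F. independent f F"
  using independent_sequence[of f] unfolding independent_def by blast

section \<open>Completeness of Jan for finite frames with a greatest element\<close>

lemma IPC_plus_mono:
  assumes "p \<in> IPC_plus X" "X \<subseteq> Y" shows "p \<in> IPC_plus Y"
  using assms(1)
proof (induction rule: IPC_plus.induct)
  case (extra p)
  then show ?case using assms(2) by (blast intro: IPC_plus.extra)
next
  case (MP p q)
  then show ?case by (blast intro: IPC_plus.MP)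
qed (rule IPC_plus.intros)+

lemma IPC_plus_weaken: "q \<in> IPC_plus X \<Longrightarrow> Imp p q \<in> IPC_plus X"
  by (rule IPC_plus.MP[OF IPC_plus.K])

lemma IPC_plus_S: "Imp p (Imp q r) \<in> IPC_plus X \<Longrightarrow> Imp p q \<in> IPC_plus X \<Longrightarrow> Imp p r \<in> IPC_plus X"
  by (rule IPC_plus.MP[OF IPC_plus.MP[OF IPC_plus.S]])

lemma IPC_plus_refl: "Imp p p \<in> IPC_plus X"
  by (rule IPC_plus_S[OF IPC_plus.K IPC_plus.K[of p p]])

text \<open>The calculus has no substitution rule, so the members of \<open>X\<close> act as
  hypotheses just as well as axioms.\<close>

lemma deduction:
  assumes "q \<in> IPC_plus (insert p X)" shows "Imp p q \<in> IPC_plus X"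
  using assms
proof (induction rule: IPC_plus.induct)
  case (extra q)
  then show ?case using IPC_plus_refl IPC_plus_weaken[OF IPC_plus.extra] by blast
next
  case (MP q r)
  then show ?case by (blast intro: IPC_plus_S)
qed (rule IPC_plus_weaken, rule IPC_plus.intros)+

lemma IPC_plus_cut: "q \<in> IPC_plus (insert p X) \<Longrightarrow> p \<in> IPC_plus X \<Longrightarrow> q \<in> IPC_plus X"
  by (rule IPC_plus.MP[OF deduction])

text \<open>Modus ponens combines two premises, and of two members of a chain one contains the
  other.\<close>

lemma IPC_plus_chain:
  assumes C: "subset.chain \<A> C" "C \<noteq> {}" and p: "p \<in> IPC_plus (\<Union>C)"
  shows "\<exists>X\<in>C. p \<in> IPC_plus X"
  using p
proof (induction rule: IPC_plus.induct)
  case (extra p)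
  then show ?case by (blast intro: IPC_plus.extra)
next
  case (MP p q)
  then obtain X Y where XY: "X \<in> C" "Imp p q \<in> IPC_plus X" "Y \<in> C" "p \<in> IPC_plus Y" by blast
  then have "X \<subseteq> Y \<or> Y \<subseteq> X" using C(1) by (auto simp: subset_chain_def)
  then show ?case using XY by (metis IPC_plus_mono IPC_plus.MP)
qed (use C(2) in \<open>blast intro: IPC_plus.intros\<close>)+

section \<open>Prime theories\<close>

definition prime_theory :: "form set \<Rightarrow> bool" where
  "prime_theory T \<longleftrightarrow> IPC_plus T \<subseteq> T \<and> T \<noteq> UNIV \<and> (\<forall>p q. Dis p q \<in> T \<longrightarrow> p \<in> T \<or> q \<in> T)"

text \<open>A maximal set that does not derive \<open>r\<close> is prime by \<open>DisE\<close>. The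
  last conjunct is kept for \<open>r = falsum\<close>, where it says that \<open>T\<close> is
  maximal consistent.\<close>

lemma Lindenbaum:
  assumes "r \<notin> IPC_plus X"
  shows "\<exists>T. X \<subseteq> T \<and> r \<notin> T \<and> prime_theory T \<and> (\<forall>p. p \<notin> T \<longrightarrow> r \<in> IPC_plus (insert p T))"
proof -
  let ?A = "{T. X \<subseteq> T \<and> r \<notin> IPC_plus T}"
  have "\<exists>T\<in>?A. \<forall>Y\<in>?A. T \<subseteq> Y \<longrightarrow> Y = T"
  proof (rule subset_Zorn_nonempty)
    show "?A \<noteq> {}" using assms by blast
    fix C assume C: "C \<noteq> {}" "subset.chain ?A C"
    then have CA: "C \<subseteq> ?A" by (simp add: subset_chain_def)
    have "r \<notin> IPC_plus (\<Union>C)" using IPC_plus_chain[OF C(2,1)] CA by blast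
    moreover have "X \<subseteq> \<Union>C" using C(1) CA by blast
    ultimately show "\<Union>C \<in> ?A" by blast
  qed
  then obtain T where "T \<in> ?A" and T_max: "\<forall>Y\<in>?A. T \<subseteq> Y \<longrightarrow> Y = T" by (rule bexE)
  then have T: "X \<subseteq> T" "r \<notin> IPC_plus T" by simp_all
  have max: "r \<in> IPC_plus (insert p T)" if "p \<notin> T" for p
  proof (rule ccontr)
    assume "r \<notin> IPC_plus (insert p T)"
    then have "insert p T \<in> ?A" using T(1) by auto
    with T_max have "insert p T = T" by blast
    with that show False by blast
  qed
  have "p \<in> T" if "p \<in> IPC_plus T" for p
    using max[of p] that T(2) IPC_plus_cut by blast
  moreover have "r \<notin> T" using T(2) IPC_plus.extra by blast
  moreover have "p \<in> T \<or> q \<in> T" if d: "Dis p q \<in> T" for p q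
  proof (rule ccontr)
    assume "\<not> (p \<in> T \<or> q \<in> T)"
    then have "Imp p r \<in> IPC_plus T" "Imp q r \<in> IPC_plus T" using max deduction by blast+
    then have "Imp (Dis p q) r \<in> IPC_plus T" by (meson IPC_plus.DisE IPC_plus.MP)
    then have "r \<in> IPC_plus T" using d by (meson IPC_plus.extra IPC_plus.MP)
    with T(2) show False ..
  qed
  ultimately show ?thesis using T(1) max unfolding prime_theory_def by blast
qed

lemma
  assumes T: "prime_theory T"
  shows prime_theory_closed: "p \<in> IPC_plus T \<Longrightarrow> p \<in> T"
    and prime_theory_MP: "Imp p q \<in> T \<Longrightarrow> p \<in> T \<Longrightarrow> q \<in> T"
    and prime_theory_Con: "Con p q \<in> T \<longleftrightarrow> p \<in> T \<and> q \<in> T"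
    and prime_theory_Dis: "Dis p q \<in> T \<longleftrightarrow> p \<in> T \<or> q \<in> T"
    and prime_theory_Neg: "Neg p \<in> T \<Longrightarrow> p \<notin> T"
proof -
  show closed: "p \<in> IPC_plus T \<Longrightarrow> p \<in> T" for p using T unfolding prime_theory_def by blast
  show MP: "Imp p q \<in> T \<Longrightarrow> p \<in> T \<Longrightarrow> q \<in> T" for p q
    by (meson closed IPC_plus.extra IPC_plus.MP)
  show "Con p q \<in> T \<longleftrightarrow> p \<in> T \<and> q \<in> T"
    by (meson MP closed IPC_plus.ConI IPC_plus.ConE1 IPC_plus.ConE2)
  show "Dis p q \<in> T \<longleftrightarrow> p \<in> T \<or> q \<in> T"
    using T unfolding prime_theory_def by (meson MP closed IPC_plus.DisI1 IPC_plus.DisI2)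
  show "p \<notin> T" if "Neg p \<in> T"
  proof
    assume "p \<in> T"
    have "q \<in> T" for q by (rule MP[OF MP[OF closed[OF IPC_plus.NegE] that] \<open>p \<in> T\<close>])
    then show False using T unfolding prime_theory_def by blast
  qed
qed

lemma prime_theory_Imp_iff:
  assumes T: "prime_theory T"
  shows "Imp p q \<in> T \<longleftrightarrow> (\<forall>T'. prime_theory T' \<longrightarrow> T \<subseteq> T' \<longrightarrow> p \<in> T' \<longrightarrow> q \<in> T')"
proof
  assume *: "\<forall>T'. prime_theory T' \<longrightarrow> T \<subseteq> T' \<longrightarrow> p \<in> T' \<longrightarrow> q \<in> T'"
  show "Imp p q \<in> T"
  proof (rule ccontr)
    assume "Imp p q \<notin> T"
    then have "q \<notin> IPC_plus (insert p T)" using deduction prime_theory_closed[OF T] by blast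
    from Lindenbaum[OF this] * show False by blast
  qed
qed (blast dest: prime_theory_MP)

text \<open>The language has no constant for falsity; any contradiction serves.\<close>

definition falsum :: form where
  "falsum = Con (Atom 0) (Neg (Atom 0))"

lemma falsum_notin: "prime_theory T \<Longrightarrow> falsum \<notin> T"
  using prime_theory_Con prime_theory_Neg unfolding falsum_def by blast

lemma Neg_of_falsum:
  assumes "falsum \<in> IPC_plus (insert p T)" shows "Neg p \<in> IPC_plus T"
proof -
  have "Imp p falsum \<in> IPC_plus T" using assms by (rule deduction)
  then have "Imp p (Atom 0) \<in> IPC_plus T" "Imp p (Neg (Atom 0)) \<in> IPC_plus T"
    unfolding falsum_def
    by (meson IPC_plus_S IPC_plus_weaken IPC_plus.ConE1 IPC_plus.ConE2)+
  then show ?thesis by (meson IPC_plus.NegI IPC_plus.MP)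
qed

lemma prime_theory_Neg_iff:
  assumes T: "prime_theory T"
  shows "Neg p \<in> T \<longleftrightarrow> (\<forall>T'. prime_theory T' \<longrightarrow> T \<subseteq> T' \<longrightarrow> p \<notin> T')"
proof
  assume *: "\<forall>T'. prime_theory T' \<longrightarrow> T \<subseteq> T' \<longrightarrow> p \<notin> T'"
  show "Neg p \<in> T"
  proof (rule ccontr)
    assume "Neg p \<notin> T"
    then have "falsum \<notin> IPC_plus (insert p T)" using Neg_of_falsum prime_theory_closed[OF T] by blast
    from Lindenbaum[OF this] * show False by blast
  qed
qed (blast dest: prime_theory_Neg)

section \<open>Finite models\<close>

primrec subforms :: "form \<Rightarrow> form set" where
  "subforms (Atom n) = {Atom n}"
| "subforms (Con p q) = insert (Con p q) (subforms p \<union> subforms q)"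
| "subforms (Dis p q) = insert (Dis p q) (subforms p \<union> subforms q)"
| "subforms (Imp p q) = insert (Imp p q) (subforms p \<union> subforms q)"
| "subforms (Neg p) = insert (Neg p) (subforms p)"

lemma finite_subforms: "finite (subforms p)"
  by (induction p) simp_all

lemma subforms_self: "p \<in> subforms p"
  by (cases p) simp_all

lemma subforms_trans: "q \<in> subforms p \<Longrightarrow> subforms q \<subseteq> subforms p"
  by (induction p) auto

text \<open>A finite Kripke frame with a least and a greatest world; a world is the set of the
  formulas in \<open>\<Sigma>\<close> that it forces, and the order is inclusion.\<close>

locale topped_model =
  fixes \<Sigma> :: "form set" and Wd :: "form set set" and root top :: "form set"
  assumes closed: "p \<in> \<Sigma> \<Longrightarrow> subforms p \<subseteq> \<Sigma>"
    and finite_worlds: "finite Wd"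
    and root: "root \<in> Wd" "w \<in> Wd \<Longrightarrow> root \<subseteq> w"
    and top: "top \<in> Wd" "w \<in> Wd \<Longrightarrow> w \<subseteq> top"
    and Con_iff: "Con p q \<in> \<Sigma> \<Longrightarrow> w \<in> Wd \<Longrightarrow> Con p q \<in> w \<longleftrightarrow> p \<in> w \<and> q \<in> w"
    and Dis_iff: "Dis p q \<in> \<Sigma> \<Longrightarrow> w \<in> Wd \<Longrightarrow> Dis p q \<in> w \<longleftrightarrow> p \<in> w \<or> q \<in> w"
    and Imp_iff: "Imp p q \<in> \<Sigma> \<Longrightarrow> w \<in> Wd \<Longrightarrow>
      Imp p q \<in> w \<longleftrightarrow> (\<forall>w'\<in>Wd. w \<subseteq> w' \<longrightarrow> p \<in> w' \<longrightarrow> q \<in> w')"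
    and Neg_iff: "Neg p \<in> \<Sigma> \<Longrightarrow> w \<in> Wd \<Longrightarrow> Neg p \<in> w \<longleftrightarrow> p \<notin> top"

text \<open>The greatest world is a maximal consistent extension \<open>M\<close> of the root \<open>T0\<close>: by weak excluded
  middle, a formula consistent with \<open>T0\<close> has its double negation in \<open>T0\<close> and hence belongs to
  \<open>M\<close>.\<close>

theorem Jan_complete:
  assumes "p \<notin> Jan"
  shows "\<exists>\<Sigma> Wd root top. topped_model \<Sigma> Wd root top \<and> p \<in> \<Sigma> \<and> p \<notin> root"
proof -
  let ?X = "{Dis (Neg p) (Neg (Neg p)) | p. True}" and ?S = "subforms p"
  obtain T0 where T0: "?X \<subseteq> T0" "p \<notin> T0" "prime_theory T0"
    using Lindenbaum[OF assms[unfolded Jan_def]] by (elim exE conjE)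
  have "falsum \<notin> IPC_plus T0"
    using falsum_notin[OF T0(3)] prime_theory_closed[OF T0(3)] by (rule contrapos_nn)
  from Lindenbaum[OF this] obtain M where M: "T0 \<subseteq> M" "prime_theory M"
    and max: "\<forall>q. q \<notin> M \<longrightarrow> falsum \<in> IPC_plus (insert q M)"
    by (elim exE conjE)
  have le_M: "T \<subseteq> M" if T: "prime_theory T" "T0 \<subseteq> T" for T
  proof
    fix q assume q: "q \<in> T"
    then have "Neg q \<notin> T0" using prime_theory_Neg T by blast
    moreover have "Dis (Neg q) (Neg (Neg q)) \<in> T0" using T0(1) by blast
    ultimately have "Neg (Neg q) \<in> M" using prime_theory_Dis[OF T0(3)] M(1) by blast
    then have "Neg q \<notin> M" using prime_theory_Neg[OF M(2)] by blast
    then show "q \<in> M" using max Neg_of_falsum prime_theory_closed[OF M(2)] by blast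
  qed
  let ?P = "{T. prime_theory T \<and> T0 \<subseteq> T}"
  \<comment> \<open>Filtration: identifying theories that contain the same subformulas makes the set
    of worlds finite.\<close>
  let ?W = "(\<lambda>T. T \<inter> ?S) ` ?P"
  have "topped_model ?S ?W (T0 \<inter> ?S) (M \<inter> ?S)"
  proof
    show "subforms q \<subseteq> ?S" if "q \<in> ?S" for q using that by (rule subforms_trans)
    have "?W \<subseteq> Pow ?S" by blast
    then show "finite ?W" by (rule finite_subset) (simp add: finite_subforms)
    show "T0 \<inter> ?S \<in> ?W" "M \<inter> ?S \<in> ?W" using T0(3) M by blast+
    show "T0 \<inter> ?S \<subseteq> w" "w \<subseteq> M \<inter> ?S" if "w \<in> ?W" for w using that le_M by auto
    fix q r w
    assume w: "w \<in> ?W"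
    then obtain T where T: "prime_theory T" "T0 \<subseteq> T" and w: "w = T \<inter> ?S" by blast
    show "Con q r \<in> w \<longleftrightarrow> q \<in> w \<and> r \<in> w" if "Con q r \<in> ?S"
      using that subforms_trans[OF that] subforms_self[of q] subforms_self[of r]
      unfolding w by (auto simp: prime_theory_Con[OF T(1)])
    show "Dis q r \<in> w \<longleftrightarrow> q \<in> w \<or> r \<in> w" if "Dis q r \<in> ?S"
      using that subforms_trans[OF that] subforms_self[of q] subforms_self[of r]
      unfolding w by (auto simp: prime_theory_Dis[OF T(1)])
    show "Neg q \<in> w \<longleftrightarrow> q \<notin> M \<inter> ?S" if "Neg q \<in> ?S"
    proof -
      have "Neg q \<in> T \<longleftrightarrow> q \<notin> M"
        unfolding prime_theory_Neg_iff[OF T(1)] using T M(2) le_M by blast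
      then show ?thesis
        using that subforms_trans[OF that] subforms_self[of q] unfolding w by auto
    qed
    show "Imp q r \<in> w \<longleftrightarrow> (\<forall>w'\<in>?W. w \<subseteq> w' \<longrightarrow> q \<in> w' \<longrightarrow> r \<in> w')" if "Imp q r \<in> ?S"
    proof
      have qr: "q \<in> ?S" "r \<in> ?S"
        using subforms_trans[OF that] subforms_self[of q] subforms_self[of r] by auto
      show "\<forall>w'\<in>?W. w \<subseteq> w' \<longrightarrow> q \<in> w' \<longrightarrow> r \<in> w'" if "Imp q r \<in> w"
        using that qr prime_theory_MP by blast
      assume *: "\<forall>w'\<in>?W. w \<subseteq> w' \<longrightarrow> q \<in> w' \<longrightarrow> r \<in> w'"
      have "r \<in> T'" if T': "prime_theory T'" "T \<subseteq> T'" "q \<in> T'" for T'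
      proof -
        have "T' \<inter> ?S \<in> ?W" using T(2) T' by blast
        moreover have "w \<subseteq> T' \<inter> ?S" using T'(2) unfolding w by blast
        ultimately show ?thesis using * T'(3) qr(1) by blast
      qed
      then have "Imp q r \<in> T" unfolding prime_theory_Imp_iff[OF T(1)] by blast
      then show "Imp q r \<in> w" using that unfolding w by blast
    qed
  qed
  then show ?thesis using T0(2) subforms_self[of p] by blast
qed

section \<open>Refuting formulas in the Medvedev lattice\<close>

lemma mdegree_join_eqI:
  "a \<le> c \<Longrightarrow> b \<le> c \<Longrightarrow> c \<le> mdegree_join a b \<Longrightarrow> mdegree_join a b = c"
  by (intro antisym mdegree_join_le)

lemma mdegree_meet_eqI:
  "c \<le> a \<Longrightarrow> c \<le> b \<Longrightarrow> mdegree_meet a b \<le> c \<Longrightarrow> mdegree_meet a b = c"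
  by (intro antisym mdegree_meet_ge)

lemma mdegree_meet_abs_le:
  "mdegree_meet (abs_mdegree A) (abs_mdegree B) \<le> abs_mdegree (mp_meet A B)"
  unfolding mdegree_meet_def abs_le_abs
  by (meson medvedev_le_trans medvedev_meet_ge medvedev_meet_le1 medvedev_meet_le2 rep_abs_le)

lemma mdegree_imp_eq_least: "b \<le> a \<Longrightarrow> mdegree_imp a b = abs_mdegree UNIV"
  by (intro antisym least_mdegree) (meson mdegree_imp_le_iff mdegree_join_ge1 order_trans)

text \<open>With \<open>a \<rightarrow> A \<ge> J \<ge> a\<close>, the join of \<open>a\<close> and \<open>a \<rightarrow> A\<close> is \<open>a \<rightarrow> A\<close> itself.\<close>

lemma mdegree_imp_eq_top:
  assumes J: "join_irreducible medvedev J" "J \<le> A" and a: "a \<le> J" "\<not> J \<le> a"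
  shows "mdegree_imp a A = A"
proof (rule antisym)
  show "mdegree_imp a A \<le> A" unfolding mdegree_imp_le_iff by (rule mdegree_join_ge2)
  have A: "A \<le> mdegree_join a (mdegree_imp a A)"
    using mdegree_imp_le_iff by blast
  then have "J \<le> mdegree_imp a A" using join_prime[OF J(1)] J(2) a(2) order_trans by blast
  then have "mdegree_join a (mdegree_imp a A) \<le> mdegree_imp a A"
    using a(1) by (intro mdegree_join_le) auto
  with A show "A \<le> mdegree_imp a A" by (rule order_trans)
qed

section \<open>The upset lattices inside the Medvedev lattice\<close>

context independent
begin

lemma join_problem:
  assumes "upset n B" "upset n C"
  shows "mdegree_join (abs_mdegree (problem B)) (abs_mdegree (problem C)) =
    abs_mdegree (problem (B \<inter> C))"
proof (rule mdegree_join_eqI)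
  show "abs_mdegree (problem (B \<inter> C)) \<le>
      mdegree_join (abs_mdegree (problem B)) (abs_mdegree (problem C))"
    unfolding mdegree_join_abs abs_le_abs using assms by (rule problem_Int_le)
qed (simp_all add: abs_le_abs medvedev_le_subset problem_mono)

lemma meet_problem:
  assumes "upset n B" "upset n C"
  shows "mdegree_meet (abs_mdegree (problem B)) (abs_mdegree (problem C)) =
    abs_mdegree (problem (B \<union> C))"
proof (rule mdegree_meet_eqI)
  show "mdegree_meet (abs_mdegree (problem B)) (abs_mdegree (problem C)) \<le>
      abs_mdegree (problem (B \<union> C))"
    using mdegree_meet_abs_le problem_Un_ge[OF assms] unfolding abs_le_abs[symmetric]
    by (rule order_trans)
qed (simp_all add: abs_le_abs medvedev_le_subset problem_mono)

lemma imp_problem: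
  assumes "upset n B" "upset n C"
  shows "mdegree_imp (abs_mdegree (problem B)) (abs_mdegree (problem C)) =
    abs_mdegree (problem (upset_imp n B C))"
proof (rule antisym)
  show "mdegree_imp (abs_mdegree (problem B)) (abs_mdegree (problem C)) \<le>
      abs_mdegree (problem (upset_imp n B C))"
    unfolding mdegree_imp_le_iff mdegree_join_abs abs_le_abs using assms by (rule problem_le_join_imp)
  let ?z = "mdegree_imp (abs_mdegree (problem B)) (abs_mdegree (problem C))"
  have "abs_mdegree (problem C) \<le> mdegree_join (abs_mdegree (problem B)) (abs_mdegree (rep_mdegree ?z))"
    unfolding abs_rep using mdegree_imp_le_iff by blast
  then have "problem C \<le>\<^sub>M mp_join (problem B) (rep_mdegree ?z)"
    unfolding mdegree_join_abs abs_le_abs .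
  from problem_imp_le[OF assms this] show "abs_mdegree (problem (upset_imp n B C)) \<le> ?z"
    unfolding abs_le_abs[symmetric] abs_rep .
qed

end

text \<open>The model is spread over the cube of all sets of indices of worlds: a nonempty chain is sent to
  its greatest element, the empty set to the root, and everything that is not a chain to the top.\<close>

locale enumerated_model = topped_model +
  fixes n :: nat and world :: "nat \<Rightarrow> form set"
  assumes worlds: "world ` {..<n} = Wd"
begin

section \<open>The map from the cube to the model\<close>

definition chain :: "nat set \<Rightarrow> bool" where
  "chain K \<longleftrightarrow> (\<forall>i\<in>K. \<forall>j\<in>K. world i \<subseteq> world j \<or> world j \<subseteq> world i)"

definition forced :: "nat set \<Rightarrow> form set" where
  "forced K = (if chain K then root \<union> \<Union> (world ` K) else top)"

definition truth_set :: "form \<Rightarrow> nat set set" where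
  "truth_set p = {K. K \<subseteq> {..<n} \<and> p \<in> forced K}"

lemma chain_subset: "chain K \<Longrightarrow> K' \<subseteq> K \<Longrightarrow> chain K'"
  unfolding chain_def by blast

lemma chain_Union_in_Wd:
  assumes "finite K" "K \<subseteq> {..<n}" "chain K" shows "root \<union> \<Union> (world ` K) \<in> Wd"
  using assms
proof (induction rule: finite_induct)
  case empty
  show ?case using root(1) by simp
next
  case (insert i K)
  let ?v = "root \<union> \<Union> (world ` K)"
  have v: "?v \<in> Wd" using insert.IH insert.prems chain_subset by blast
  have i: "world i \<in> Wd" using insert.prems worlds by blast
  have "world i \<union> ?v = world i \<or> world i \<union> ?v = ?v"
  proof (cases "\<forall>j\<in>K. world j \<subseteq> world i")
    case True
    then show ?thesis using root(2)[OF i] by blast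
  next
    case False
    then obtain j where "j \<in> K" "\<not> world j \<subseteq> world i" by blast
    then have "world i \<subseteq> world j" using insert.prems(2) unfolding chain_def by blast
    with \<open>j \<in> K\<close> show ?thesis by blast
  qed
  moreover have "root \<union> \<Union> (world ` insert i K) = world i \<union> ?v" by blast
  ultimately show ?case using v i by metis
qed

lemma forced_in_Wd: "K \<subseteq> {..<n} \<Longrightarrow> forced K \<in> Wd"
  using chain_Union_in_Wd[OF finite_subset[OF _ finite_lessThan]] top(1) unfolding forced_def by simp

lemma forced_mono:
  assumes "K \<subseteq> K'" "K' \<subseteq> {..<n}" shows "forced K \<subseteq> forced K'"
proof (cases "chain K'")
  case True
  then have "chain K" using assms(1) by (rule chain_subset)
  with True show ?thesis unfolding forced_def using assms(1) by auto
next
  case False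
  then have "forced K' = top" by (simp add: forced_def)
  moreover have "forced K \<in> Wd" using assms by (intro forced_in_Wd) blast
  ultimately show ?thesis using top(2) by blast
qed

text \<open>The back condition, which together with \<open>forced_mono\<close> makes
  \<open>forced\<close> a p-morphism. Over a chain, the index of a world \<open>w\<close> above all
  its members can be added; over any other set only the top world is left.\<close>

lemma forced_extend:
  assumes K: "K \<subseteq> {..<n}" and w: "w \<in> Wd" "forced K \<subseteq> w"
  shows "\<exists>K'\<subseteq>{..<n}. K \<subseteq> K' \<and> forced K' = w"
proof (cases "chain K")
  case True
  obtain j where j: "j < n" "world j = w" using w(1) worlds by blast
  have *: "root \<union> \<Union> (world ` K) \<subseteq> w" using w(2) True by (simp add: forced_def)
  then have "chain (insert j K)" using True j(2) unfolding chain_def by blast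
  then have "forced (insert j K) = w" using * j(2) by (auto simp: forced_def)
  then show ?thesis using K j(1) by (intro exI[of _ "insert j K"]) auto
next
  case False
  then have "forced K = top" by (simp add: forced_def)
  then have "forced K = w" using w top(2) by blast
  with K show ?thesis by blast
qed

lemma forced_empty: "forced {} = root"
  by (simp add: forced_def chain_def)

lemma upset_truth_set: "upset n (truth_set p)"
  unfolding upset_def truth_set_def using forced_mono by blast

lemma forced_subset_top: "K \<subseteq> {..<n} \<Longrightarrow> forced K \<subseteq> top"
  using forced_in_Wd top(2) by blast

lemma truth_set_nonempty: "p \<in> top \<Longrightarrow> \<exists>K. K \<in> truth_set p"
proof -
  assume p: "p \<in> top"
  have "forced {} \<subseteq> top" by (rule forced_subset_top) simp
  then obtain K where "K \<subseteq> {..<n}" "forced K = top" using forced_extend[of "{}" top] top(1) by auto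
  with p show ?thesis unfolding truth_set_def by blast
qed

lemma truth_set_empty: "p \<notin> top \<Longrightarrow> truth_set p = {}"
  unfolding truth_set_def using forced_subset_top by blast

lemma truth_set_Con: "Con p q \<in> \<Sigma> \<Longrightarrow> truth_set (Con p q) = truth_set p \<inter> truth_set q"
  unfolding truth_set_def using Con_iff forced_in_Wd by blast

lemma truth_set_Dis: "Dis p q \<in> \<Sigma> \<Longrightarrow> truth_set (Dis p q) = truth_set p \<union> truth_set q"
  unfolding truth_set_def using Dis_iff forced_in_Wd by blast

text \<open>The two conditions of a p-morphism translate quantification over later worlds into
  quantification over larger sets.\<close>

lemma truth_set_Imp:
  assumes "Imp p q \<in> \<Sigma>" shows "truth_set (Imp p q) = upset_imp n (truth_set p) (truth_set q)"
proof (rule set_eqI)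
  fix K
  show "K \<in> truth_set (Imp p q) \<longleftrightarrow> K \<in> upset_imp n (truth_set p) (truth_set q)"
  proof (cases "K \<subseteq> {..<n}")
    case True
    have "Imp p q \<in> forced K \<longleftrightarrow> (\<forall>w\<in>Wd. forced K \<subseteq> w \<longrightarrow> p \<in> w \<longrightarrow> q \<in> w)"
      using Imp_iff[OF assms forced_in_Wd[OF True]] .
    also have "\<dots> \<longleftrightarrow> (\<forall>K'\<subseteq>{..<n}. K \<subseteq> K' \<longrightarrow> p \<in> forced K' \<longrightarrow> q \<in> forced K')"
    proof
      assume *: "\<forall>w\<in>Wd. forced K \<subseteq> w \<longrightarrow> p \<in> w \<longrightarrow> q \<in> w"
      show "\<forall>K'\<subseteq>{..<n}. K \<subseteq> K' \<longrightarrow> p \<in> forced K' \<longrightarrow> q \<in> forced K'"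
      proof (intro allI impI)
        fix K' assume K': "K' \<subseteq> {..<n}" "K \<subseteq> K'" and "p \<in> forced K'"
        with * show "q \<in> forced K'" using forced_in_Wd[OF K'(1)] forced_mono[OF K'(2,1)] by blast
      qed
    next
      assume *: "\<forall>K'\<subseteq>{..<n}. K \<subseteq> K' \<longrightarrow> p \<in> forced K' \<longrightarrow> q \<in> forced K'"
      show "\<forall>w\<in>Wd. forced K \<subseteq> w \<longrightarrow> p \<in> w \<longrightarrow> q \<in> w"
      proof (intro ballI impI)
        fix w assume "w \<in> Wd" "forced K \<subseteq> w" "p \<in> w"
        then obtain K' where "K' \<subseteq> {..<n}" "K \<subseteq> K'" "forced K' = w"
          using forced_extend[OF True, of w] by blast
        with * \<open>p \<in> w\<close> show "q \<in> w" by blast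
      qed
    qed
    finally show ?thesis using True unfolding truth_set_def upset_imp_def by auto
  qed (auto simp: truth_set_def upset_imp_def)
qed

end

section \<open>Evaluation of formulas below \<open>A\<close>\<close>

lemma factor_medvedev_simps:
  "join (factor medvedev a) = mdegree_join" "meet (factor medvedev a) = mdegree_meet"
  "imp (factor medvedev a) = mdegree_imp" "greatest (factor medvedev a) = a"
  "least (factor medvedev a) = abs_mdegree UNIV" "carr (factor medvedev a) = {b. b \<le> a}"
  by (simp_all add: factor_def medvedev_def)

text \<open>Formulas that fail at \<open>top\<close> fail everywhere and take the value
  \<open>A\<close>. All others take a degree strictly below \<open>J\<close>, so by
  \<open>mdegree_imp_eq_top\<close> their negations take the value \<open>A\<close>, as the frame
  demands.\<close>

lemma (in topped_model) refuted:
  assumes J: "join_irreducible medvedev J" "zero_prime < J" "J \<le> A"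
    and r: "r \<in> \<Sigma>" "r \<notin> root"
  shows "r \<notin> Th (factor medvedev A)"
proof -
  obtain world where world: "world ` {..<card Wd} = Wd"
    using ex_bij_betw_nat_finite[OF finite_worlds] by (auto simp: bij_betw_def atLeast0LessThan)
  then interpret enumerated_model \<Sigma> Wd root top "card Wd" world by unfold_locales
  have "\<not> J \<le> zero_prime" using J(2) by (simp add: less_mdegree_def)
  then obtain f where f: "\<not> computable f" "\<not> J \<le> abs_mdegree {f}"
    using ex_noncomputable_not_above[OF J(1)] by blast
  obtain F where "independent f F" using ex_independent[OF f(1)] by blast
  then interpret independent f F .
  define X where "X p = abs_mdegree (problem (truth_set p))" for p
  \<comment> \<open>An atom failing at \<open>top\<close> has an empty truth set, whose problem has
    the greatest degree and need not lie below \<open>A\<close>; the value \<open>A\<close> takes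
    its place.\<close>
  define v where "v k = (if Atom k \<in> top then X (Atom k) else A)" for k
  have JR: "\<not> rep_mdegree J \<le>\<^sub>M {f}" using f(2) unfolding abs_le_abs[symmetric] abs_rep .
  have X: "X p \<le> J" "\<not> J \<le> X p" if p: "p \<in> top" for p
  proof -
    obtain K where K: "K \<in> truth_set p" using truth_set_nonempty[OF p] by blast
    show "X p \<le> J"
      using problem_le[OF upset_truth_set K JR] unfolding X_def abs_le_abs[symmetric] abs_rep .
    show "\<not> J \<le> X p"
      using not_le_problem[OF upset_truth_set K JR] unfolding X_def abs_le_abs[symmetric] abs_rep .
  qed
  have XA: "X p \<le> A" if "p \<in> top" for p using X(1)[OF that] J(3) by (rule order_trans)
  have zero: "X p = abs_mdegree UNIV" if "{} \<in> truth_set p" for p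
    unfolding X_def using problem_UNIV[OF that, of UNIV]
    by (intro antisym least_mdegree) (simp add: abs_le_abs)
  have form_value: "form_value (factor medvedev A) v p = (if p \<in> top then X p else A)" if "p \<in> \<Sigma>" for p
    using that
  proof (induction p)
    case (Atom k)
    show ?case by (simp add: v_def)
  next
    case (Con p q)
    have pq: "p \<in> \<Sigma>" "q \<in> \<Sigma>" using closed[OF Con.prems] subforms_self by auto
    have t: "Con p q \<in> top \<longleftrightarrow> p \<in> top \<and> q \<in> top" using Con_iff[OF Con.prems top(1)] .
    have "p \<in> top \<Longrightarrow> q \<in> top \<Longrightarrow> mdegree_join (X p) (X q) = X (Con p q)"
      unfolding X_def truth_set_Con[OF Con.prems]
      by (rule join_problem[OF upset_truth_set upset_truth_set])
    moreover have "mdegree_join a A = A" "mdegree_join A a = A" if "a \<le> A" for a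
      using that by (auto intro!: mdegree_join_eqI mdegree_join_ge1 mdegree_join_ge2)
    ultimately show ?case
      using Con.IH pq XA t by (simp add: factor_medvedev_simps)
  next
    case (Dis p q)
    have pq: "p \<in> \<Sigma>" "q \<in> \<Sigma>" using closed[OF Dis.prems] subforms_self by auto
    have t: "Dis p q \<in> top \<longleftrightarrow> p \<in> top \<or> q \<in> top" using Dis_iff[OF Dis.prems top(1)] .
    have "mdegree_meet (X p) (X q) = X (Dis p q)"
      unfolding X_def truth_set_Dis[OF Dis.prems]
      by (rule meet_problem[OF upset_truth_set upset_truth_set])
    \<comment> \<open>A disjunct that fails at \<open>top\<close> has an empty truth set, so it
      drops out of the union just as \<open>A\<close> drops out of a meet below
      \<open>A\<close>.\<close>
    moreover have "q \<notin> top \<Longrightarrow> X (Dis p q) = X p" "p \<notin> top \<Longrightarrow> X (Dis p q) = X q"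
      unfolding X_def truth_set_Dis[OF Dis.prems] by (simp_all add: truth_set_empty)
    moreover have "mdegree_meet a A = a" "mdegree_meet A a = a" if "a \<le> A" for a
      using that by (auto intro!: mdegree_meet_eqI mdegree_meet_le1 mdegree_meet_le2)
    ultimately show ?case
      using Dis.IH pq XA t by (simp add: factor_medvedev_simps)
  next
    case (Imp p q)
    have pq: "p \<in> \<Sigma>" "q \<in> \<Sigma>" using closed[OF Imp.prems] subforms_self by auto
    have t: "Imp p q \<in> top \<longleftrightarrow> (p \<in> top \<longrightarrow> q \<in> top)"
      using Imp_iff[OF Imp.prems top(1)] top by blast
    have 1: "mdegree_imp (X p) (X q) = X (Imp p q)"
      unfolding X_def truth_set_Imp[OF Imp.prems]
      by (rule imp_problem[OF upset_truth_set upset_truth_set])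
    have 2: "X (Imp p q) = abs_mdegree UNIV" if "p \<notin> top"
    proof (rule zero)
      show "{} \<in> truth_set (Imp p q)"
        unfolding truth_set_Imp[OF Imp.prems] truth_set_empty[OF that] upset_imp_def by simp
    qed
    have 3: "mdegree_imp (X p) A = A" if "p \<in> top"
      using mdegree_imp_eq_top[OF J(1,3) X[OF that]] .
    show ?case
      using Imp.IH(1)[OF pq(1)] Imp.IH(2)[OF pq(2)] 1 2 3 t XA
      by (auto simp: factor_medvedev_simps mdegree_imp_eq_least)
  next
    case (Neg p)
    have p: "p \<in> \<Sigma>" using closed[OF Neg.prems] subforms_self by auto
    have t: "Neg p \<in> top \<longleftrightarrow> p \<notin> top" using Neg_iff[OF Neg.prems top(1)] .
    have 2: "X (Neg p) = abs_mdegree UNIV" if "p \<notin> top"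
    proof (rule zero)
      show "{} \<in> truth_set (Neg p)"
        using Neg_iff[OF Neg.prems root(1)] that unfolding truth_set_def by (simp add: forced_empty)
    qed
    show ?case
      using Neg.IH[OF p] t 2 mdegree_imp_eq_top[OF J(1,3) X]
      by (simp add: factor_medvedev_simps mdegree_imp_eq_least)
  qed
  have "form_value (factor medvedev A) v r \<noteq> abs_mdegree UNIV"
  proof (cases "r \<in> top")
    case True
    \<comment> \<open>The empty set is sent to the root, where \<open>r\<close> fails.\<close>
    have "{} \<notin> truth_set r" using r(2) unfolding truth_set_def by (simp add: forced_empty)
    from problem_nonzero[OF this] have "\<not> X r \<le> abs_mdegree UNIV" unfolding X_def abs_le_abs .
    then show ?thesis using form_value[OF r(1)] True by auto
  next
    case False
    have "\<not> A \<le> abs_mdegree UNIV"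
      using J least_mdegree[of zero_prime] by (meson order_trans less_mdegree_def)
    then show ?thesis using form_value[OF r(1)] False by auto
  qed
  moreover have "range v \<subseteq> carr (factor medvedev A)"
    unfolding factor_medvedev_simps v_def using XA by auto
  ultimately show ?thesis unfolding Th_def factor_medvedev_simps by blast
qed

theorem theorem7p1:
  fixes A :: mdegree
  assumes "\<exists>J. join_irreducible medvedev J \<and> zero_prime < J \<and> J \<le> A"
  shows "Th (factor medvedev A) \<subseteq> Jan"
proof
  fix r assume r: "r \<in> Th (factor medvedev A)"
  obtain J where J: "join_irreducible medvedev J" "zero_prime < J" "J \<le> A" using assms by blast
  show "r \<in> Jan"
  proof (rule ccontr)
    assume "r \<notin> Jan"
    from Jan_complete[OF this] obtain \<Sigma> Wd root top
      where "topped_model \<Sigma> Wd root top" "r \<in> \<Sigma>" "r \<notin> root" by (elim exE conjE)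
    from topped_model.refuted[OF this(1) J this(2,3)] r show False by (rule notE)
  qed
qed

end
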